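(* $\mathsf{AST}\in\Pi^0_2$.
   Context: pGCL. Fix a countable set $\mathrm{Var}$ of variables taking rational values. Programs are generated by $P ::= \bot \mid v:=e \mid P;P \mid P\oplus_p P \mid P\,[\!]\,P \mid \mathtt{while}(b)\{P\}$ ($v\in\mathrm{Var}$, $e,p$ arithmetical expressions, $b$ boolean expression, $\bot$ the empty program; $\oplus_p$ probabilistic choice, $[\!]$ nondeterministic choice). A valuation is $\eta:\mathrm{Var}\to\mathbb{Q}$. A scheduler is a total function $f:\{L_n,R_n,L_p,R_p\}^*\to\{L_n,R_n\}$; $\mathbb{F}$ is the set of schedulers. An execution state is $(P,\eta,a,w)$ with $a\in\mathbb{Q}\cap(0,1]$, $w\in\{L_n,R_n,L_p,R_p\}^*$; states with program $\bot$ are terminal. For $f\in\mathbb{F}$, $\to_f$ is the smallest relation with: $(v:=e,\eta,a,w)\to_f(\bot,\eta[v\mapsto[\![e]\!]_\eta],a,w)$; if $(P_1,\eta,a,w)\to_f(P_1',\eta',a',w')$ then $(P_1;P_2,\eta,a,w)\to_f(P_1';P_2,\eta',a',w')$; $(\bot;P_2,\eta,a,w)\to_f(P_2,\eta,a,w)$; $(P_1\oplus_pP_2,\eta,a,w)\to_f(P_2,\eta,a,wR_p)$ if $[\![p]\!]_\eta\le0$, $\to_f(P_1,\eta,a,wL_p)$ if $[\![p]\!]_\eta\ge1$, and if $0<[\![p]\!]_\eta<1$ both $\to_f(P_1,\eta,a[\![p]\!]_\eta,wL_p)$ and $\to_f(P_2,\eta,a(1-[\![p]\!]_\eta),wR_p)$;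 $(P_1[\!]P_2,\eta,a,w)\to_f(P_1,\eta,a,wL_n)$ if $f(w)=L_n$, $\to_f(P_2,\eta,a,wR_n)$ if $f(w)=R_n$; $(\mathtt{while}(b)\{P\},\eta,a,w)\to_f(P;\mathtt{while}(b)\{P\},\eta,a,w)$ if $b$ holds, else $\to_f(\bot,\eta,a,w)$. $\to_f^*$ is the transitive closure. The initial execution state of $P$ is $(P,\eta_0,1,\varepsilon)$, $\eta_0\equiv0$. $\mathrm{Prob}((P,\eta,a,w))=a$. $\Pr_{\mathrm{term}}(P,f)=\sum\mathrm{Prob}(\tau)$ over all terminal execution states $\tau$ with $(P,\eta_0,1,\varepsilon)\to_f^*\tau$. $\mathsf{AST}$ is the set of programs $P$ with $\Pr_{\mathrm{term}}(P,f)=1$ for every scheduler $f$. Programs are identified with natural numbers via a fixed effective encoding; $\Pi^0_2$ is the second universal level of the arithmetical hierarchy. *)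

theory Defs
  imports "HOL-Analysis.Analysis" "HOL-Library.Nat_Bijection"
begin

datatype aexp = N rat | V nat | Plus aexp aexp | Minus aexp aexp
  | Times aexp aexp | Div aexp aexp

datatype bexp = BConst bool | Less aexp aexp | Eq aexp aexp
  | Not bexp | And bexp bexp | Or bexp bexp

datatype prog = Bot | Assign nat aexp | Seq prog prog
  | PChoice prog aexp prog
  | NChoice prog prog
  | While bexp prog

type_synonym valuation = "nat \<Rightarrow> rat"

fun aval :: "aexp \<Rightarrow> valuation \<Rightarrow> rat" where
  "aval (N q) \<eta> = q"
| "aval (V v) \<eta> = \<eta> v"
| "aval (Plus e1 e2) \<eta> = aval e1 \<eta> + aval e2 \<eta>"
| "aval (Minus e1 e2) \<eta> = aval e1 \<eta> - aval e2 \<eta>"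
| "aval (Times e1 e2) \<eta> = aval e1 \<eta> * aval e2 \<eta>"
| "aval (Div e1 e2) \<eta> = aval e1 \<eta> / aval e2 \<eta>"

fun bval :: "bexp \<Rightarrow> valuation \<Rightarrow> bool" where
  "bval (BConst c) \<eta> = c"
| "bval (Less e1 e2) \<eta> = (aval e1 \<eta> < aval e2 \<eta>)"
| "bval (Eq e1 e2) \<eta> = (aval e1 \<eta> = aval e2 \<eta>)"
| "bval (Not b) \<eta> = (\<not> bval b \<eta>)"
| "bval (And b1 b2) \<eta> = (bval b1 \<eta> \<and> bval b2 \<eta>)"
| "bval (Or b1 b2) \<eta> = (bval b1 \<eta> \<or> bval b2 \<eta>)"

datatype dir = Ln | Rn | Lp | Rp

definition schedulers :: "(dir list \<Rightarrow> dir) set" where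
  "schedulers = {f. \<forall>w. f w \<in> {Ln, Rn}}"

type_synonym state = "prog \<times> valuation \<times> rat \<times> dir list"

inductive step :: "(dir list \<Rightarrow> dir) \<Rightarrow> state \<Rightarrow> state \<Rightarrow> bool" for f where
  assign: "step f (Assign v e, \<eta>, a, w) (Bot, \<eta>(v := aval e \<eta>), a, w)"
| seq: "step f (P1, \<eta>, a, w) (P1', \<eta>', a', w') \<Longrightarrow>
        step f (Seq P1 P2, \<eta>, a, w) (Seq P1' P2, \<eta>', a', w')"
| seq_bot: "step f (Seq Bot P2, \<eta>, a, w) (P2, \<eta>, a, w)"
| prob_le0: "aval p \<eta> \<le> 0 \<Longrightarrow> step f (PChoice P1 p P2, \<eta>, a, w) (P2, \<eta>, a, w @ [Rp])"
| prob_ge1: "aval p \<eta> \<ge> 1 \<Longrightarrow> step f (PChoice P1 p P2, \<eta>, a, w) (P1, \<eta>, a, w @ [Lp])"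
| prob_L: "0 < aval p \<eta> \<Longrightarrow> aval p \<eta> < 1 \<Longrightarrow>
        step f (PChoice P1 p P2, \<eta>, a, w) (P1, \<eta>, a * aval p \<eta>, w @ [Lp])"
| prob_R: "0 < aval p \<eta> \<Longrightarrow> aval p \<eta> < 1 \<Longrightarrow>
        step f (PChoice P1 p P2, \<eta>, a, w) (P2, \<eta>, a * (1 - aval p \<eta>), w @ [Rp])"
| nd_L: "f w = Ln \<Longrightarrow> step f (NChoice P1 P2, \<eta>, a, w) (P1, \<eta>, a, w @ [Ln])"
| nd_R: "f w = Rn \<Longrightarrow> step f (NChoice P1 P2, \<eta>, a, w) (P2, \<eta>, a, w @ [Rn])"
| while_T: "bval b \<eta> \<Longrightarrow> step f (While b P, \<eta>, a, w) (Seq P (While b P), \<eta>, a, w)"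
| while_F: "\<not> bval b \<eta> \<Longrightarrow> step f (While b P, \<eta>, a, w) (Bot, \<eta>, a, w)"

definition init_state :: "prog \<Rightarrow> state" where
  "init_state P = (P, (\<lambda>_. 0), 1, [])"

definition sprob :: "state \<Rightarrow> rat" where
  "sprob s = fst (snd (snd s))"

definition terminal :: "state \<Rightarrow> bool" where
  "terminal s \<longleftrightarrow> fst s = Bot"

definition Pr_term :: "prog \<Rightarrow> (dir list \<Rightarrow> dir) \<Rightarrow> ennreal" where
  "Pr_term P f = infsum (\<lambda>s. ennreal (real_of_rat (sprob s)))
                        {s. (step f)\<^sup>*\<^sup>* (init_state P) s \<and> terminal s}"

definition AST :: "prog set" where
  "AST = {P. \<forall>f \<in> schedulers. Pr_term P f = 1}"

definition rat_code :: "rat \<Rightarrow> nat" where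
  "rat_code q = prod_encode (int_encode (fst (quotient_of q)), int_encode (snd (quotient_of q)))"

fun aexp_code :: "aexp \<Rightarrow> nat" where
  "aexp_code (N q) = prod_encode (0, rat_code q)"
| "aexp_code (V v) = prod_encode (1, v)"
| "aexp_code (Plus e1 e2) = prod_encode (2, prod_encode (aexp_code e1, aexp_code e2))"
| "aexp_code (Minus e1 e2) = prod_encode (3, prod_encode (aexp_code e1, aexp_code e2))"
| "aexp_code (Times e1 e2) = prod_encode (4, prod_encode (aexp_code e1, aexp_code e2))"
| "aexp_code (Div e1 e2) = prod_encode (5, prod_encode (aexp_code e1, aexp_code e2))"

fun bexp_code :: "bexp \<Rightarrow> nat" where
  "bexp_code (BConst c) = prod_encode (0, if c then 1 else 0)"
| "bexp_code (Less e1 e2) = prod_encode (1, prod_encode (aexp_code e1, aexp_code e2))"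
| "bexp_code (Eq e1 e2) = prod_encode (2, prod_encode (aexp_code e1, aexp_code e2))"
| "bexp_code (Not b) = prod_encode (3, bexp_code b)"
| "bexp_code (And b1 b2) = prod_encode (4, prod_encode (bexp_code b1, bexp_code b2))"
| "bexp_code (Or b1 b2) = prod_encode (5, prod_encode (bexp_code b1, bexp_code b2))"

fun prog_code :: "prog \<Rightarrow> nat" where
  "prog_code Bot = prod_encode (0, 0)"
| "prog_code (Assign v e) = prod_encode (1, prod_encode (v, aexp_code e))"
| "prog_code (Seq P1 P2) = prod_encode (2, prod_encode (prog_code P1, prog_code P2))"
| "prog_code (PChoice P1 p P2) =
     prod_encode (3, prod_encode (prog_code P1, prod_encode (aexp_code p, prog_code P2)))"
| "prog_code (NChoice P1 P2) = prod_encode (4, prod_encode (prog_code P1, prog_code P2))"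
| "prog_code (While b P) = prod_encode (5, prod_encode (bexp_code b, prog_code P))"

datatype aterm = TVar nat | TZero | TSuc aterm | TPlus aterm aterm | TTimes aterm aterm

datatype aform = FEq aterm aterm | FLess aterm aterm | FNot aform
  | FAnd aform aform | FOr aform aform
  | FBAll nat aterm aform
  | FBEx nat aterm aform

fun teval :: "aterm \<Rightarrow> (nat \<Rightarrow> nat) \<Rightarrow> nat" where
  "teval (TVar i) env = env i"
| "teval TZero env = 0"
| "teval (TSuc t) env = Suc (teval t env)"
| "teval (TPlus t u) env = teval t env + teval u env"
| "teval (TTimes t u) env = teval t env * teval u env"

text \<open>All quantifiers in an aform are bounded, so aforms are exactly the
  Delta_0 (bounded) formulas of first-order arithmetic.\<close>
fun feval :: "aform \<Rightarrow> (nat \<Rightarrow> nat) \<Rightarrow> bool" where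
  "feval (FEq t u) env = (teval t env = teval u env)"
| "feval (FLess t u) env = (teval t env < teval u env)"
| "feval (FNot \<phi>) env = (\<not> feval \<phi> env)"
| "feval (FAnd \<phi> \<psi>) env = (feval \<phi> env \<and> feval \<psi> env)"
| "feval (FOr \<phi> \<psi>) env = (feval \<phi> env \<or> feval \<psi> env)"
| "feval (FBAll i t \<phi>) env = (\<forall>x < teval t env. feval \<phi> (env(i := x)))"
| "feval (FBEx i t \<phi>) env = (\<exists>x < teval t env. feval \<phi> (env(i := x)))"

definition Pi02 :: "nat set \<Rightarrow> bool" where
  "Pi02 A \<longleftrightarrow> (\<exists>\<phi>. \<forall>n. n \<in> A \<longleftrightarrow>
      (\<forall>x. \<exists>y. feval \<phi> ((\<lambda>_. 0)(0 := n, 1 := x, 2 := y))))"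

end

(* Value iteration: assign to a program in a valuation the supremum of the rationals q for which a
   finite certificate shows that every scheduler terminates with probability at least q. At a
   nondeterministic choice this value is at least the minimum over the two branches, so the scheduler
   that always moves to a branch of smaller value terminates with probability at most the value.
   Hence P is in AST iff for every x there is a certificate for P and 1 - 1/(x+1). Certificates are
   derivation trees of a system of computable rules with at most two premises; existence of such a
   tree is Sigma_1, because a finite set of ranked facts can be coded by divisibility among
   Goedel's pairwise coprime numbers 1 + (p + 1) b. *)

theory Submission
  imports Defs
begin

section \<open>Sigma-1 predicates on environments\<close>

text \<open>Schedulers are functions, so quantifying over them is not arithmetical. A certificate
  does not mention the scheduler and bounds all of them at once; only quantifiers over numbers
  remain. That certificates for every 1 - 1/(x+1) exist when P is in \<open>AST\<close> would
  usually call for a compactness argument over schedulers. The value avoids it: if the value of a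
  choice lay below those of both branches, a rational strictly in between would certify both
  branches and hence the choice. \<open>Pi02\<close> asks for one block "for all x, exists y" over a
  bounded formula, so computability has to be built up from formulas. Predicates closed under
  conjunction, disjunction, bounded universal and unbounded existential quantification are used, and
  at the end the single variable y bounds all the existential quantifiers. Negation is not among the
  closure properties, which shapes many definitions: inequality is "less or greater",
  non-divisibility is a nonzero remainder, truth values are carried as data. Valuations are infinite
  objects, but runs from the zero valuation only reach finitely supported ones, which lists can
  code.\<close>

inductive poly_term :: "((nat \<Rightarrow> nat) \<Rightarrow> nat) \<Rightarrow> bool" where
  poly_var: "poly_term (\<lambda>e. e i)"
| poly_0: "poly_term (\<lambda>e. 0)"
| poly_Suc: "poly_term t \<Longrightarrow> poly_term (\<lambda>e. Suc (t e))"
| poly_add: "poly_term t \<Longrightarrow> poly_term u \<Longrightarrow> poly_term (\<lambda>e. t e + u e)"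
| poly_mult: "poly_term t \<Longrightarrow> poly_term u \<Longrightarrow> poly_term (\<lambda>e. t e * u e)"

text \<open>Environments are de Bruijn style: a quantifier pushes its value with \<^const>\<open>case_nat\<close>.\<close>

inductive sigma_env :: "((nat \<Rightarrow> nat) \<Rightarrow> bool) \<Rightarrow> bool" where
  se_eq: "poly_term t \<Longrightarrow> poly_term u \<Longrightarrow> sigma_env (\<lambda>e. t e = u e)"
| se_less: "poly_term t \<Longrightarrow> poly_term u \<Longrightarrow> sigma_env (\<lambda>e. t e < u e)"
| se_conj: "sigma_env R \<Longrightarrow> sigma_env S \<Longrightarrow> sigma_env (\<lambda>e. R e \<and> S e)"
| se_disj: "sigma_env R \<Longrightarrow> sigma_env S \<Longrightarrow> sigma_env (\<lambda>e. R e \<or> S e)"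
| se_ball: "poly_term t \<Longrightarrow> sigma_env R \<Longrightarrow> sigma_env (\<lambda>e. \<forall>x<t e. R (case_nat x e))"
| se_ex: "sigma_env R \<Longrightarrow> sigma_env (\<lambda>e. \<exists>x. R (case_nat x e))"

lemma poly_term_rename: "poly_term t \<Longrightarrow> poly_term (\<lambda>e. t (\<lambda>i. e (\<rho> i)))"
  by (induction rule: poly_term.induct) (simp_all add: poly_term.intros)

definition lift_renaming :: "(nat \<Rightarrow> nat) \<Rightarrow> nat \<Rightarrow> nat" where
  "lift_renaming \<rho> = case_nat 0 (\<lambda>i. Suc (\<rho> i))"

lemma case_nat_lift_renaming:
  "(\<lambda>i. case_nat x e (lift_renaming \<rho> i)) = case_nat x (\<lambda>i. e (\<rho> i))"
  by (auto simp: fun_eq_iff lift_renaming_def split: nat.split)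

lemma sigma_env_rename: "sigma_env R \<Longrightarrow> sigma_env (\<lambda>e. R (\<lambda>i. e (\<rho> i)))"
proof (induction arbitrary: \<rho> rule: sigma_env.induct)
  case (se_ball t R)
  show ?case
    using sigma_env.se_ball[OF poly_term_rename[OF se_ball.hyps(1)] se_ball.IH[of "lift_renaming \<rho>"]]
    unfolding case_nat_lift_renaming .
next
  case (se_ex R)
  show ?case
    using sigma_env.se_ex[OF se_ex.IH[of "lift_renaming \<rho>"]]
    unfolding case_nat_lift_renaming .
next
  case (se_eq t u)
  show ?case by (rule sigma_env.se_eq[OF se_eq[THEN poly_term_rename]])
next
  case (se_less t u)
  show ?case by (rule sigma_env.se_less[OF se_less[THEN poly_term_rename]])
next
  case (se_conj R S)
  show ?case by (rule sigma_env.se_conj[OF se_conj.IH])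
next
  case (se_disj R S)
  show ?case by (rule sigma_env.se_disj[OF se_disj.IH])
qed

text \<open>\<open>\<rho>\<close> carries the passage from de Bruijn indices to the named variables
  of \<open>aterm\<close>.\<close>

lemma poly_term_aterm:
  "poly_term t \<Longrightarrow> \<exists>t'. \<forall>env. teval t' env = t (\<lambda>i. env (\<rho> i))"
proof (induction rule: poly_term.induct)
  case (poly_var i)
  show ?case by (rule exI[of _ "TVar (\<rho> i)"]) simp
next
  case poly_0
  show ?case by (rule exI[of _ TZero]) simp
next
  case (poly_Suc t)
  then obtain t' where "\<forall>env. teval t' env = t (\<lambda>i. env (\<rho> i))" by blast
  then show ?case by (intro exI[of _ "TSuc t'"]) simp
next
  case (poly_add t u)
  then obtain t' u' where "\<forall>env. teval t' env = t (\<lambda>i. env (\<rho> i))"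
    "\<forall>env. teval u' env = u (\<lambda>i. env (\<rho> i))" by blast
  then show ?case by (intro exI[of _ "TPlus t' u'"]) simp
next
  case (poly_mult t u)
  then obtain t' u' where "\<forall>env. teval t' env = t (\<lambda>i. env (\<rho> i))"
    "\<forall>env. teval u' env = u (\<lambda>i. env (\<rho> i))" by blast
  then show ?case by (intro exI[of _ "TTimes t' u'"]) simp
qed

text \<open>Variable 2 is the place of the witness y in \<open>Pi02\<close>. The second clause is
  the invariant that the induction has to carry: already for a conjunction, two separate bounds are
  merged by passing to the larger one.\<close>

definition reflects :: "aform \<Rightarrow> ((nat \<Rightarrow> nat) \<Rightarrow> bool) \<Rightarrow> bool" where
  "reflects \<phi> R \<longleftrightarrow> (\<forall>env. (R env \<longleftrightarrow> (\<exists>b. feval \<phi> (env(2 := b))))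
     \<and> (\<forall>b b'. b \<le> b' \<longrightarrow> feval \<phi> (env(2 := b)) \<longrightarrow> feval \<phi> (env(2 := b'))))"

text \<open>Going under a binder gives de Bruijn index 0 the name \<open>d\<close>. It exceeds all
  names in use as well as 2, so writing to \<open>d\<close> disturbs neither the other indices nor
  the bound.\<close>

lemma reflects_push:
  assumes "reflects \<phi> (\<lambda>env. R (\<lambda>i. env (case_nat d \<rho> i)))" "\<forall>i. \<rho> i < d" "2 < d"
  shows "R (case_nat x (\<lambda>i. env (\<rho> i))) \<longleftrightarrow> (\<exists>b. feval \<phi> (env(2 := b, d := x)))"
    and "b \<le> b' \<Longrightarrow> feval \<phi> (env(2 := b, d := x)) \<Longrightarrow> feval \<phi> (env(2 := b', d := x))"
proof -
  have e: "(\<lambda>i. (env(d := x)) (case_nat d \<rho> i)) = case_nat x (\<lambda>i. env (\<rho> i))"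
    using assms(2) by (auto simp: fun_eq_iff less_not_refl3 split: nat.split)
  have c: "env(2 := b, d := x) = (env(d := x))(2 := b)" for b
    using assms(3) by (simp add: fun_upd_twist)
  note h = assms(1)[unfolded reflects_def, rule_format, of "env(d := x)"]
  show "R (case_nat x (\<lambda>i. env (\<rho> i))) \<longleftrightarrow> (\<exists>b. feval \<phi> (env(2 := b, d := x)))"
    using h unfolding e c by blast
  show "b \<le> b' \<Longrightarrow> feval \<phi> (env(2 := b, d := x)) \<Longrightarrow> feval \<phi> (env(2 := b', d := x))"
    using h unfolding c by blast
qed

text \<open>Variable 2 bounds every unbounded quantifier. Monotonicity in this bound is what makes
  the bounded universal quantifier commute with it (collection).\<close>

lemma sigma_env_reflects:
  "sigma_env R \<Longrightarrow> \<forall>i. \<rho> i < d \<and> \<rho> i \<noteq> 2 \<Longrightarrow> 2 < d \<Longrightarrow>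
    \<exists>\<phi>. reflects \<phi> (\<lambda>env. R (\<lambda>i. env (\<rho> i)))"
proof (induction arbitrary: \<rho> d rule: sigma_env.induct)
  case (se_eq t u)
  obtain t' u' where "\<forall>env. teval t' env = t (\<lambda>i. env (\<rho> i))"
    "\<forall>env. teval u' env = u (\<lambda>i. env (\<rho> i))"
    using poly_term_aterm[of t \<rho>] poly_term_aterm[of u \<rho>] se_eq.hyps by blast
  then show ?case using se_eq.prems
    by (intro exI[of _ "FEq t' u'"]) (simp add: reflects_def)
next
  case (se_less t u)
  obtain t' u' where "\<forall>env. teval t' env = t (\<lambda>i. env (\<rho> i))"
    "\<forall>env. teval u' env = u (\<lambda>i. env (\<rho> i))"
    using poly_term_aterm[of t \<rho>] poly_term_aterm[of u \<rho>] se_less.hyps by blast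
  then show ?case using se_less.prems
    by (intro exI[of _ "FLess t' u'"]) (simp add: reflects_def)
next
  case (se_conj R S)
  obtain \<phi> \<psi> where h: "reflects \<phi> (\<lambda>env. R (\<lambda>i. env (\<rho> i)))"
    "reflects \<psi> (\<lambda>env. S (\<lambda>i. env (\<rho> i)))"
    using se_conj by blast
  show ?case
  proof (intro exI[of _ "FAnd \<phi> \<psi>"], unfold reflects_def, intro allI conjI)
    fix env
    show "(R (\<lambda>i. env (\<rho> i)) \<and> S (\<lambda>i. env (\<rho> i))) = (\<exists>b. feval (FAnd \<phi> \<psi>) (env(2 := b)))"
      using h unfolding reflects_def feval.simps by (metis le_cases)
  qed (use h in \<open>auto simp: reflects_def\<close>)
next
  case (se_disj R S)
  obtain \<phi> \<psi> where h: "reflects \<phi> (\<lambda>env. R (\<lambda>i. env (\<rho> i)))"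
    "reflects \<psi> (\<lambda>env. S (\<lambda>i. env (\<rho> i)))"
    using se_disj by blast
  then show ?case
    by (intro exI[of _ "FOr \<phi> \<psi>"]) (auto simp: reflects_def)
next
  case (se_ball t R)
  obtain t' where t': "\<forall>env. teval t' env = t (\<lambda>i. env (\<rho> i))"
    using poly_term_aterm[of t \<rho>] se_ball.hyps by blast
  have "\<forall>i. case_nat d \<rho> i < Suc d \<and> case_nat d \<rho> i \<noteq> 2"
    using se_ball.prems by (auto simp: less_Suc_eq split: nat.split)
  from se_ball.IH[OF this] obtain \<phi> where "reflects \<phi> (\<lambda>env. R (\<lambda>i. env (case_nat d \<rho> i)))"
    using se_ball.prems(2) by auto
  have "\<forall>i. \<rho> i < d" using se_ball.prems by blast
  note push = reflects_push[OF \<open>reflects \<phi> _\<close> this se_ball.prems(2)]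
  have t2: "teval t' (env(2 := b)) = t (\<lambda>i. env (\<rho> i))" for env b
    using t' se_ball.prems(1) by simp
  show ?case
  proof (intro exI[of _ "FBAll d t' \<phi>"], unfold reflects_def, intro allI conjI impI iffI)
    fix env assume "\<forall>x<t (\<lambda>i. env (\<rho> i)). R (case_nat x (\<lambda>i. env (\<rho> i)))"
    then have "\<forall>x<t (\<lambda>i. env (\<rho> i)). \<exists>b. feval \<phi> (env(2 := b, d := x))"
      using push(1) by blast
    then obtain B where B: "\<forall>x<t (\<lambda>i. env (\<rho> i)). feval \<phi> (env(2 := B x, d := x))"
      by metis
    \<comment> \<open>The sum of the individual bounds dominates each \<open>B x\<close>, so
      monotonicity makes it a common bound.\<close>
    have "\<forall>x<t (\<lambda>i. env (\<rho> i)). feval \<phi> (env(2 := (\<Sum>x<t (\<lambda>i. env (\<rho> i)). B x), d := x))"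
    proof (intro allI impI)
      fix x assume x: "x < t (\<lambda>i. env (\<rho> i))"
      then have "B x \<le> (\<Sum>x<t (\<lambda>i. env (\<rho> i)). B x)"
        by (intro member_le_sum) auto
      with B x push(2) show "feval \<phi> (env(2 := (\<Sum>x<t (\<lambda>i. env (\<rho> i)). B x), d := x))"
        by blast
    qed
    then show "\<exists>b. feval (FBAll d t' \<phi>) (env(2 := b))" unfolding feval.simps t2 by blast
  next
    fix env x assume "\<exists>b. feval (FBAll d t' \<phi>) (env(2 := b))" "x < t (\<lambda>i. env (\<rho> i))"
    then show "R (case_nat x (\<lambda>i. env (\<rho> i)))"
      unfolding feval.simps t2 push(1) by blast
  next
    fix env and b b' :: nat
    assume "b \<le> b'" "feval (FBAll d t' \<phi>) (env(2 := b))"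
    then show "feval (FBAll d t' \<phi>) (env(2 := b'))"
      unfolding feval.simps t2 using push(2) by blast
  qed
next
  case (se_ex R)
  have "\<forall>i. case_nat d \<rho> i < Suc d \<and> case_nat d \<rho> i \<noteq> 2"
    using se_ex.prems by (auto simp: less_Suc_eq split: nat.split)
  from se_ex.IH[OF this] obtain \<phi> where "reflects \<phi> (\<lambda>env. R (\<lambda>i. env (case_nat d \<rho> i)))"
    using se_ex.prems(2) by auto
  have "\<forall>i. \<rho> i < d" using se_ex.prems by blast
  note push = reflects_push[OF \<open>reflects \<phi> _\<close> this se_ex.prems(2)]
  show ?case
  proof (intro exI[of _ "FBEx d (TVar 2) \<phi>"], unfold reflects_def, intro allI conjI impI iffI)
    fix env assume "\<exists>x. R (case_nat x (\<lambda>i. env (\<rho> i)))"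
    then obtain x b where "feval \<phi> (env(2 := b, d := x))"
      using push(1) by blast
    \<comment> \<open>\<open>FBEx\<close> ranges strictly below variable 2, so the new bound must
      exceed the witness \<open>x\<close> besides reaching \<open>b\<close>.\<close>
    then have "feval \<phi> (env(2 := max b (Suc x), d := x))"
      using push(2)[OF max.cobounded1] by blast
    moreover have "x < teval (TVar 2) (env(2 := max b (Suc x)))" by simp
    ultimately show "\<exists>b. feval (FBEx d (TVar 2) \<phi>) (env(2 := b))"
      unfolding feval.simps by blast
  next
    fix env assume "\<exists>b. feval (FBEx d (TVar 2) \<phi>) (env(2 := b))"
    then show "\<exists>x. R (case_nat x (\<lambda>i. env (\<rho> i)))"
      unfolding feval.simps push(1) by blast
  next
    fix env and b b' :: nat
    assume "b \<le> b'" "feval (FBEx d (TVar 2) \<phi>) (env(2 := b))"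
    then obtain x where x: "x < b" "feval \<phi> (env(2 := b, d := x))"
      unfolding feval.simps teval.simps fun_upd_same by blast
    have "feval \<phi> (env(2 := b', d := x))" "x < b'"
      using x push(2) \<open>b \<le> b'\<close> by (blast, linarith)
    then show "feval (FBEx d (TVar 2) \<phi>) (env(2 := b'))"
      unfolding feval.simps teval.simps fun_upd_same by blast
  qed
qed

lemma sigma_env_Pi02:
  assumes "sigma_env R" "\<And>n. n \<in> A \<longleftrightarrow> (\<forall>x. R (case_nat n (case_nat x (\<lambda>_. 0))))"
  shows "Pi02 A"
proof -
  \<comment> \<open>Indices from 2 on denote 0 in the target environment; they are sent to variable
    3, which \<open>Pi02\<close> leaves at 0, since 2 is reserved for the bound.\<close>
  define \<rho> :: "nat \<Rightarrow> nat" where "\<rho> i = (if i < 2 then i else 3)" for i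
  have "\<forall>i. \<rho> i < 4 \<and> \<rho> i \<noteq> 2" by (simp add: \<rho>_def)
  from sigma_env_reflects[OF assms(1) this]
  obtain \<phi> where h: "reflects \<phi> (\<lambda>env. R (\<lambda>i. env (\<rho> i)))" by auto
  have e: "(\<lambda>i. ((\<lambda>_. 0)(0 := n, 1 := x)) (\<rho> i)) = case_nat n (case_nat x (\<lambda>_. 0))"
    for n x :: nat
    by (auto simp: fun_eq_iff \<rho>_def split: nat.split)
  have "R (case_nat n (case_nat x (\<lambda>_. 0))) \<longleftrightarrow> (\<exists>y. feval \<phi> ((\<lambda>_. 0)(0 := n, 1 := x, 2 := y)))"
    for n x
    using h[unfolded reflects_def, rule_format, of "(\<lambda>_. 0)(0 := n, 1 := x)"] unfolding e by blast
  then show ?thesis unfolding Pi02_def assms(2) by (intro exI[of _ \<phi>]) simp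
qed

section \<open>Encodable types and computable functions\<close>

text \<open>Restates \<open>se_ex\<close> for an ordinary bound variable: unification with
  \<open>R x e\<close> finds the de Bruijn form, so that \<open>intro\<close> can treat formulas
  written in the usual way.\<close>

lemma se_exI: "sigma_env (\<lambda>e. R (e 0) (\<lambda>i. e (Suc i))) \<Longrightarrow> sigma_env (\<lambda>e. \<exists>x. R x e)"
  using se_ex[of "\<lambda>e. R (e 0) (\<lambda>i. e (Suc i))"] by simp

lemma se_ballI:
  "poly_term t \<Longrightarrow> sigma_env (\<lambda>e. R (e 0) (\<lambda>i. e (Suc i))) \<Longrightarrow> sigma_env (\<lambda>e. \<forall>x<t e. R x e)"
  using se_ball[of t "\<lambda>e. R (e 0) (\<lambda>i. e (Suc i))"] by simp

lemma se_at1: "sigma_env (\<lambda>e. P (e 0)) \<Longrightarrow> sigma_env (\<lambda>e. P (e i))"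
  using sigma_env_rename[of "\<lambda>e. P (e 0)" "\<lambda>_. i"] by simp

lemma se_at2: "sigma_env (\<lambda>e. P (e 0) (e 1)) \<Longrightarrow> sigma_env (\<lambda>e. P (e i) (e j))"
  using sigma_env_rename[of "\<lambda>e. P (e 0) (e 1)" "case_nat i (\<lambda>_. j)"] by simp

text \<open>\<open>triangle\<close> halves a product; doubling the equation leaves polynomials on
  both sides.\<close>

lemma prod_encode_iff: "p = prod_encode (m, n) \<longleftrightarrow> p + p = (m + n) * Suc (m + n) + (m + m)"
proof -
  have "2 * triangle (m + n) = (m + n) * Suc (m + n)" by (simp add: triangle_def)
  then show ?thesis unfolding prod_encode_def prod.case by linarith
qed

lemma se_prod_encode: "sigma_env (\<lambda>e. e i = prod_encode (e j, e k))"
  unfolding prod_encode_iff by (intro se_eq poly_term.intros)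

text \<open>The codes prescribed for rationals and programs do not exhaust the naturals. A formula
  about elements of the type must be able to say that a number is a code, so recognisability of the
  range belongs to the class.\<close>

class enc =
  fixes enc :: "'a \<Rightarrow> nat"
  assumes inj_enc: "inj enc"
    and sigma_range_enc: "sigma_env (\<lambda>e. \<exists>x. e 0 = enc x)"

lemma enc_eq_iff [simp]: "enc x = enc y \<longleftrightarrow> x = y"
  by (rule inj_eq[OF inj_enc])

lemma se_range: "sigma_env (\<lambda>e. \<exists>x::'a::enc. e i = enc x)"
  using se_at1[of "\<lambda>n. \<exists>x::'a. n = enc x"] sigma_range_enc by blast

instantiation nat :: enc
begin
definition enc_nat :: "nat \<Rightarrow> nat" where [simp]: "enc_nat n = n"
instance
proof
  show "sigma_env (\<lambda>e. \<exists>x::nat. e 0 = enc x)"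
    by (intro se_exI, simp only: enc_nat_def, intro se_eq poly_term.intros)
qed (simp add: inj_on_def)
end

instantiation prod :: (enc, enc) enc
begin
definition enc_prod :: "'a \<times> 'b \<Rightarrow> nat" where
  "enc_prod z = prod_encode (enc (fst z), enc (snd z))"
instance
proof
  have "sigma_env (\<lambda>e. \<exists>m n. e 0 = prod_encode (m, n) \<and> (\<exists>x::'a. m = enc x) \<and> (\<exists>y::'b. n = enc y))"
    by (intro se_exI se_conj se_prod_encode se_range)
  then show "sigma_env (\<lambda>e. \<exists>z::'a \<times> 'b. e 0 = enc z)"
    by (rule back_subst[of sigma_env]) (auto simp: enc_prod_def fun_eq_iff)
qed (auto simp: enc_prod_def inj_on_def)
end

lemma enc_Pair [simp]: "enc (x, y) = prod_encode (enc x, enc y)"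
  by (simp add: enc_prod_def)

definition sig :: "('a::enc \<Rightarrow> bool) \<Rightarrow> bool" where
  "sig R \<longleftrightarrow> sigma_env (\<lambda>e. \<exists>x. e 0 = enc x \<and> R x)"

text \<open>A total function is recursive exactly when its graph is Sigma_1; this characterisation
  serves as the definition.\<close>

definition computable :: "('a::enc \<Rightarrow> 'b::enc) \<Rightarrow> bool" where
  "computable f \<longleftrightarrow> sigma_env (\<lambda>e. \<exists>x. e 0 = enc x \<and> e 1 = enc (f x))"

lemma se_sig: "sig R \<Longrightarrow> sigma_env (\<lambda>e. \<exists>x. e i = enc x \<and> R x)"
  unfolding sig_def by (rule se_at1[of "\<lambda>n. \<exists>x. n = enc x \<and> R x"])

lemma se_computable: "computable f \<Longrightarrow> sigma_env (\<lambda>e. \<exists>x. e i = enc x \<and> e j = enc (f x))"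
  unfolding computable_def by (rule se_at2[of "\<lambda>m n. \<exists>x. m = enc x \<and> n = enc (f x)"])

lemma sig_via:
  assumes "sigma_env S" "\<And>e. S e \<longleftrightarrow> (\<exists>x. e 0 = enc x \<and> R x)"
  shows "sig R"
proof -
  have "S = (\<lambda>e. \<exists>x. e 0 = enc x \<and> R x)" using assms(2) by (rule ext)
  with assms(1) show ?thesis by (simp add: sig_def)
qed

lemma computable_via:
  assumes "sigma_env S" "\<And>e. S e \<longleftrightarrow> (\<exists>x. e 0 = enc x \<and> e 1 = enc (f x))"
  shows "computable f"
proof -
  have "S = (\<lambda>e. \<exists>x. e 0 = enc x \<and> e 1 = enc (f x))" using assms(2) by (rule ext)
  with assms(1) show ?thesis by (simp add: computable_def)
qed

lemma sig_cong: "(\<And>x. R x \<longleftrightarrow> S x) \<Longrightarrow> sig S \<Longrightarrow> sig R"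
  by (simp add: sig_def)

lemma sig_conj: "sig R \<Longrightarrow> sig S \<Longrightarrow> sig (\<lambda>x. R x \<and> S x)"
  by (rule sig_via[OF se_conj[OF se_sig[of R 0] se_sig[of S 0]]]) auto

lemma sig_disj: "sig R \<Longrightarrow> sig S \<Longrightarrow> sig (\<lambda>x. R x \<or> S x)"
  by (rule sig_via[OF se_disj[OF se_sig[of R 0] se_sig[of S 0]]]) auto

lemma sig_ex:
  assumes "sig (\<lambda>z. R (fst z) (snd z))"
  shows "sig (\<lambda>x. \<exists>y. R x y)"
proof (rule sig_via)
  show "sigma_env (\<lambda>e. \<exists>n p. p = prod_encode (e 0, n) \<and> (\<exists>z. p = enc z \<and> R (fst z) (snd z)))"
    by (intro se_exI se_conj se_prod_encode se_sig[OF assms])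
qed (auto simp: enc_prod_def)

lemma computable_id: "computable (\<lambda>x::'a::enc. x)"
proof (rule computable_via)
  show "sigma_env (\<lambda>e. (\<exists>x::'a. e 0 = enc x) \<and> e 0 = e 1)"
    by (intro se_conj se_eq poly_term.intros se_range)
qed auto

lemma poly_const: "poly_term (\<lambda>_. c)"
  by (induction c) (rule poly_0, erule poly_Suc)

lemma computable_const: "computable (\<lambda>_::'a::enc. c)"
proof (rule computable_via)
  show "sigma_env (\<lambda>e. (\<exists>x::'a. e 0 = enc x) \<and> e 1 = enc c)"
    by (intro se_conj se_eq poly_var poly_const se_range)
qed auto

lemma computable_Pair:
  assumes "computable f" "computable g"
  shows "computable (\<lambda>x. (f x, g x))"
proof (rule computable_via)
  show "sigma_env (\<lambda>e. \<exists>m n. e 1 = prod_encode (m, n) \<and> (\<exists>x. e 0 = enc x \<and> m = enc (f x))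
      \<and> (\<exists>x. e 0 = enc x \<and> n = enc (g x)))"
    by (intro se_exI se_conj se_prod_encode se_computable assms)
qed auto

lemma computable_comp:
  assumes "computable f" "computable g"
  shows "computable (\<lambda>x. g (f x))"
proof (rule computable_via)
  show "sigma_env (\<lambda>e. \<exists>m. (\<exists>x. e 0 = enc x \<and> m = enc (f x)) \<and> (\<exists>y. m = enc y \<and> e 1 = enc (g y)))"
    by (intro se_exI se_conj se_computable assms)
qed auto

lemma sig_subst:
  assumes "computable f" "sig R"
  shows "sig (\<lambda>x. R (f x))"
proof (rule sig_via)
  show "sigma_env (\<lambda>e. \<exists>m. (\<exists>x. e 0 = enc x \<and> m = enc (f x)) \<and> (\<exists>y. m = enc y \<and> R y))"
    by (intro se_exI se_conj se_computable se_sig assms)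
qed auto

text \<open>\<open>enc\<close> is the identity on the naturals, so both sides have the same graph.
  This reduces computability of a constructor to the equation for its code.\<close>

lemma computable_enc_iff: "computable (\<lambda>x. enc (f x)) \<longleftrightarrow> computable f"
  by (simp add: computable_def)

lemmas computable_encD = computable_enc_iff[THEN iffD1]
lemmas computable_enc = computable_enc_iff[THEN iffD2]

lemma computable_fst:
  fixes f :: "'c::enc \<Rightarrow> 'a::enc \<times> 'b::enc"
  shows "computable f \<Longrightarrow> computable (\<lambda>x. fst (f x))"
proof (erule computable_comp, rule computable_via)
  show "sigma_env (\<lambda>e. \<exists>n. e 0 = prod_encode (e 1, n) \<and> (\<exists>x::'a. e 1 = enc x) \<and> (\<exists>y::'b. n = enc y))"
    by (intro se_exI se_conj se_prod_encode se_range)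
qed auto

lemma computable_snd:
  fixes f :: "'c::enc \<Rightarrow> 'a::enc \<times> 'b::enc"
  shows "computable f \<Longrightarrow> computable (\<lambda>x. snd (f x))"
proof (erule computable_comp, rule computable_via)
  show "sigma_env (\<lambda>e. \<exists>m. e 0 = prod_encode (m, e 1) \<and> (\<exists>x::'a. m = enc x) \<and> (\<exists>y::'b. e 1 = enc y))"
    by (intro se_exI se_conj se_prod_encode se_range)
qed auto

lemma sig_eq:
  assumes "computable f" "computable g"
  shows "sig (\<lambda>x. f x = g x)"
proof (rule sig_via)
  show "sigma_env (\<lambda>e. \<exists>m. (\<exists>x. e 0 = enc x \<and> m = enc (f x)) \<and> (\<exists>x. e 0 = enc x \<and> m = enc (g x)))"
    by (intro se_exI se_conj se_computable assms)
qed auto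

text \<open>Suited to functions whose graph is easy to describe, such as those defined by recursion
  or by inverting a code.\<close>

lemma computable_graph:
  assumes "sig (\<lambda>z. snd z = f (fst z))"
  shows "computable f"
proof (rule computable_via)
  show "sigma_env (\<lambda>e. \<exists>p. p = prod_encode (e 0, e 1) \<and> (\<exists>z. p = enc z \<and> snd z = f (fst z)))"
    by (intro se_exI se_conj se_prod_encode se_sig assms)
qed (auto simp: enc_prod_def)

lemma computable_Suc: "computable f \<Longrightarrow> computable (\<lambda>x. Suc (f x))"
proof (erule computable_comp, rule computable_via)
  show "sigma_env (\<lambda>e. e 1 = Suc (e 0))" by (intro se_eq poly_term.intros)
qed simp

lemma computable_add_nat: "computable f \<Longrightarrow> computable g \<Longrightarrow> computable (\<lambda>x. f x + g x :: nat)"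
proof (rule computable_comp[OF computable_Pair, where g = "\<lambda>z. fst z + snd z", simplified], assumption+, rule computable_via)
  show "sigma_env (\<lambda>e. \<exists>m n. e 0 = prod_encode (m, n) \<and> e 1 = m + n)"
    by (intro se_exI se_conj se_prod_encode se_eq poly_term.intros)
qed simp

lemma computable_mult_nat: "computable f \<Longrightarrow> computable g \<Longrightarrow> computable (\<lambda>x. f x * g x :: nat)"
proof (rule computable_comp[OF computable_Pair, where g = "\<lambda>z. fst z * snd z", simplified], assumption+, rule computable_via)
  show "sigma_env (\<lambda>e. \<exists>m n. e 0 = prod_encode (m, n) \<and> e 1 = m * n)"
    by (intro se_exI se_conj se_prod_encode se_eq poly_term.intros)
qed simp

lemma computable_prod_encode: "computable f \<Longrightarrow> computable g \<Longrightarrow> computable (\<lambda>x. prod_encode (f x, g x))"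
  using computable_enc[OF computable_Pair, of f g] by simp

lemma sig_less_nat: "computable f \<Longrightarrow> computable g \<Longrightarrow> sig (\<lambda>x. f x < (g x :: nat))"
proof (rule sig_subst[OF computable_Pair, where R = "\<lambda>z. fst z < snd z", simplified], assumption+, rule sig_via)
  show "sigma_env (\<lambda>e. \<exists>m n. e 0 = prod_encode (m, n) \<and> m < n)"
    by (intro se_exI se_conj se_prod_encode se_less poly_term.intros)
qed simp

lemma sig_ball:
  fixes t :: "'a::enc \<Rightarrow> nat"
  assumes "computable t" "sig (\<lambda>z. R (fst z) (snd z))"
  shows "sig (\<lambda>x. \<forall>i<t x. R x i)"
proof (rule sig_via)
  show "sigma_env (\<lambda>e. \<exists>m. (\<exists>x. e 0 = enc x \<and> m = enc (t x)) \<and>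
     (\<forall>i<m. \<exists>p. p = prod_encode (e 0, i) \<and> (\<exists>z. p = enc z \<and> R (fst z) (snd z))))"
    by (intro se_exI se_conj se_prod_encode se_ballI se_sig se_computable assms poly_term.intros)
qed (auto simp: enc_prod_def)

lemmas sig_intros = sig_conj sig_disj sig_ex sig_eq sig_less_nat sig_ball
  computable_const computable_id computable_Pair computable_fst computable_snd computable_Suc computable_add_nat computable_mult_nat computable_prod_encode computable_enc

section \<open>Least fixed points of rules with at most two premises\<close>

lemma finite_set_coding:
  fixes S :: "nat set"
  assumes "finite S"
  shows "\<exists>a b M. \<forall>p. p \<in> S \<longleftrightarrow> p < M \<and> Suc (Suc p * b) dvd a"
proof -
  obtain M where M: "S \<subseteq> {..<M}" using assms finite_nat_iff_bounded by blast
  \<comment> \<open>For p < q < M the difference q - p divides M!, which is what makes the moduli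
    coprime.\<close>
  define b :: nat where "b = fact M"
  define a where "a = (\<Prod>p\<in>S. Suc (Suc p * b))"
  have lt: "coprime (Suc (Suc p * b)) (Suc (Suc q * b))" if "p < q" "q < M" for p q
  proof (rule ccontr)
    assume "\<not> ?thesis"
    then obtain c where c: "c dvd Suc (Suc p * b)" "c dvd Suc (Suc q * b)" "\<not> is_unit c"
      by (rule not_coprimeE)
    then have "c \<noteq> 1" by simp
    then obtain r where "prime r" "r dvd c" using prime_factor_nat by blast
    with c have r: "prime r" "r dvd Suc (Suc p * b)" "r dvd Suc (Suc q * b)"
      using dvd_trans by blast+
    \<comment> \<open>A common prime divisor of two moduli divides their difference, hence
      \<open>b\<close>, hence 1.\<close>
    have "Suc (Suc q * b) - Suc (Suc p * b) = (q - p) * b"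
      by (simp add: diff_mult_distrib)
    then have "r dvd (q - p) * b" using dvd_diff_nat[OF r(3) r(2)] by simp
    moreover have "q - p dvd b" unfolding b_def using that by (intro dvd_fact) auto
    ultimately have "r dvd b" using r(1) prime_dvd_mult_iff[of r] dvd_trans by blast
    then have "r dvd Suc p * b" by (rule dvd_mult)
    then have "r dvd 1" using r(2) dvd_add_right_iff[of r "Suc p * b" 1] by simp
    then show False using r(1) by simp
  qed
  then have cop: "coprime (Suc (Suc p * b)) (Suc (Suc q * b))" if "p \<noteq> q" "p < M" "q < M" for p q
    using that lt[of p q] lt[of q p] by (cases p q rule: linorder_cases) (simp_all only: coprime_commute)
  have "p \<in> S \<longleftrightarrow> p < M \<and> Suc (Suc p * b) dvd a" for p
  proof
    assume "p \<in> S"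
    then show "p < M \<and> Suc (Suc p * b) dvd a"
      using M dvd_prodI[OF assms, of p "\<lambda>p. Suc (Suc p * b)"] unfolding a_def by blast
  next
    assume p: "p < M \<and> Suc (Suc p * b) dvd a"
    show "p \<in> S"
    proof (rule ccontr)
      assume "p \<notin> S"
      then have "coprime (Suc (Suc p * b)) a"
        unfolding a_def using M p by (intro prod_coprime_right cop) blast+
      then have "is_unit (Suc (Suc p * b))"
        using p coprime_common_divisor dvd_refl by blast
      then show False by (simp add: b_def)
    qed
  qed
  then show ?thesis by blast
qed

text \<open>Exactly two premises, so that \<open>R\<close> has one fixed type; a rule with a single
  premise is applied with the same fact in both places.\<close>

inductive clos :: "('a \<Rightarrow> bool) \<Rightarrow> ('a \<Rightarrow> 'a \<Rightarrow> 'a \<Rightarrow> bool) \<Rightarrow> 'a \<Rightarrow> bool" for A R where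
  clos_ax: "A x \<Longrightarrow> clos A R x"
| clos_step: "R x y z \<Longrightarrow> clos A R y \<Longrightarrow> clos A R z \<Longrightarrow> clos A R x"

text \<open>The ranks exclude circular support: without them a fact could justify itself, and a
  coded set would prove nothing.\<close>

definition justified ::
    "('a \<Rightarrow> bool) \<Rightarrow> ('a \<Rightarrow> 'a \<Rightarrow> 'a \<Rightarrow> bool) \<Rightarrow> (nat \<times> 'a) set \<Rightarrow> nat \<Rightarrow> 'a \<Rightarrow> bool" where
  "justified A R D i x \<longleftrightarrow> A x \<or>
     (\<exists>y z. R x y z \<and> (\<exists>j. j < i \<and> (j, y) \<in> D) \<and> (\<exists>j. j < i \<and> (j, z) \<in> D))"

definition is_derivation :: "('a \<Rightarrow> bool) \<Rightarrow> ('a \<Rightarrow> 'a \<Rightarrow> 'a \<Rightarrow> bool) \<Rightarrow> (nat \<times> 'a) set \<Rightarrow> bool" where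
  "is_derivation A R D \<longleftrightarrow> (\<forall>i x. (i, x) \<in> D \<longrightarrow> justified A R D i x)"

lemma justified_mono: "justified A R D i x \<Longrightarrow> D \<subseteq> D' \<Longrightarrow> justified A R D' i x"
  unfolding justified_def by blast

lemma clos_imp_derivation:
  "clos A R x \<Longrightarrow> \<exists>D i. finite D \<and> is_derivation A R D \<and> (i, x) \<in> D"
proof (induction rule: clos.induct)
  case (clos_ax x)
  then show ?case
    by (intro exI[of _ "{(0, x)}"] exI[of _ 0]) (simp add: is_derivation_def justified_def)
next
  case (clos_step x y z)
  then obtain D i D' j where D: "finite D" "is_derivation A R D" "(i, y) \<in> D"
    and D': "finite D'" "is_derivation A R D'" "(j, z) \<in> D'"
    by (elim exE conjE)
  \<comment> \<open>Both derivations keep their ranks in the union; \<open>Suc (i + j)\<close> lies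
    above the ranks \<open>i\<close> and \<open>j\<close> of the premises.\<close>
  let ?D = "insert (Suc (i + j), x) (D \<union> D')"
  have "justified A R ?D (Suc (i + j)) x"
  proof -
    have "\<exists>l. l < Suc (i + j) \<and> (l, y) \<in> ?D" using D(3) by (intro exI[of _ i]) simp
    moreover have "\<exists>l. l < Suc (i + j) \<and> (l, z) \<in> ?D" using D'(3) by (intro exI[of _ j]) simp
    ultimately show ?thesis using clos_step.hyps(1)
      unfolding justified_def by (intro disjI2 exI[of _ y] exI[of _ z] conjI)
  qed
  moreover have "justified A R ?D k u" if "(k, u) \<in> D \<or> (k, u) \<in> D'" for k u
    using that D(2) D'(2) justified_mono[of A R D k u ?D] justified_mono[of A R D' k u ?D]
    unfolding is_derivation_def by (elim disjE) (simp_all add: subset_insertI2)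
  ultimately have "is_derivation A R ?D"
    unfolding is_derivation_def by simp
  with D(1) D'(1) show ?case by (intro exI[of _ ?D] exI[of _ "Suc (i + j)"]) simp
qed

lemma derivation_imp_clos: "is_derivation A R D \<Longrightarrow> (i, x) \<in> D \<Longrightarrow> clos A R x"
proof (induction i arbitrary: x rule: less_induct)
  case (less i)
  then have "justified A R D i x" by (simp add: is_derivation_def)
  then consider "A x" | y z j k where "R x y z" "j < i" "(j, y) \<in> D" "k < i" "(k, z) \<in> D"
    unfolding justified_def by blast
  then show ?case
  proof cases
    case 1
    then show ?thesis by (rule clos_ax)
  next
    case 2
    show ?thesis
      by (rule clos_step[of R x y z]; (rule 2 less.IH[OF _ less.prems(1)])+)
  qed
qed

definition coded_mem :: "nat \<Rightarrow> nat \<Rightarrow> nat \<Rightarrow> nat \<Rightarrow> bool" where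
  "coded_mem a b M p \<longleftrightarrow> p < M \<and> (\<exists>q. a = q * Suc (Suc p * b))"

text \<open>Supplies the negation in Sigma_1 form: the remainder is \<open>Suc r\<close>, nonzero
  and smaller than the modulus \<open>Suc (Suc p * b)\<close>.\<close>

lemma not_coded_mem:
  "p < M \<Longrightarrow> \<not> coded_mem a b M p \<longleftrightarrow> (\<exists>q r. a = q * Suc (Suc p * b) + Suc r \<and> r < Suc p * b)"
proof -
  let ?d = "Suc (Suc p * b)"
  assume "p < M"
  then have "\<not> coded_mem a b M p \<longleftrightarrow> \<not> ?d dvd a"
    unfolding coded_mem_def by (simp only: dvd_def mult.commute[of ?d] simp_thms)
  also have "\<dots> \<longleftrightarrow> (\<exists>q r. a = q * ?d + Suc r \<and> r < Suc p * b)"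
  proof safe
    assume "\<not> ?d dvd a"
    then obtain r where "a mod ?d = Suc r"
      by (metis dvd_eq_mod_eq_0 not0_implies_Suc)
    moreover from this have "r < Suc p * b"
      by (metis Suc_less_SucD mod_less_divisor zero_less_Suc)
    ultimately show "\<exists>q r. a = q * ?d + Suc r \<and> r < Suc p * b"
      by (metis div_mult_mod_eq)
  next
    fix q r assume "r < Suc p * b" "?d dvd q * ?d + Suc r"
    then have "?d dvd Suc r" unfolding dvd_add_right_iff[OF dvd_triv_right[of ?d q]] by blast
    with \<open>r < Suc p * b\<close> show False using dvd_imp_le[of ?d "Suc r"] by simp
  qed
  finally show ?thesis .
qed

lemma sig_coded_mem:
  assumes "computable a" "computable b" "computable M" "computable p"
  shows "sig (\<lambda>x. coded_mem (a x) (b x) (M x) (p x))"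
proof -
  have "sig (\<lambda>z. coded_mem (fst z) (fst (snd z)) (fst (snd (snd z))) (snd (snd (snd z))))"
    unfolding coded_mem_def by (intro sig_intros)
  from sig_subst[OF computable_Pair[OF assms(1) computable_Pair[OF assms(2) computable_Pair[OF assms(3,4)]]] this]
  show ?thesis by simp
qed

text \<open>A whole derivation is one finite object given by \<open>a\<close>, \<open>b\<close>,
  \<open>M\<close>. That every member is justified is an implication; since remainders decide
  membership of each p < M, it becomes a disjunction of two positive statements under a bounded
  quantifier.\<close>

lemma clos_iff_coded:
  fixes A :: "'a::enc \<Rightarrow> bool"
  shows "clos A R x \<longleftrightarrow> (\<exists>a b M (i::nat). coded_mem a b M (enc (i, x)) \<and> (\<forall>p<M.
     (\<exists>q r. a = q * Suc (Suc p * b) + Suc r \<and> r < Suc p * b) \<or>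
     (\<exists>i x. p = enc (i, x) \<and> justified A R {z. coded_mem a b M (enc z)} i x)))"
    (is "_ \<longleftrightarrow> (\<exists>a b M i. ?code a b M i)")
proof
  assume "clos A R x"
  from clos_imp_derivation[OF this]
  obtain D i where D: "finite D" "is_derivation A R D" "(i, x) \<in> D"
    by (elim exE conjE)
  from D(1) have "finite (enc ` D)" by simp
  from finite_set_coding[OF this]
  obtain a b M where "\<forall>p. p \<in> enc ` D \<longleftrightarrow> p < M \<and> Suc (Suc p * b) dvd a"
    by (elim exE)
  then have mem: "coded_mem a b M p \<longleftrightarrow> p \<in> enc ` D" for p
    unfolding coded_mem_def by (simp only: dvd_def mult.commute[of "Suc (Suc p * b)"])
  have D_eq: "{z. coded_mem a b M (enc z)} = D"
    unfolding mem image_iff Bex_def enc_eq_iff by blast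
  have "?code a b M i"
  proof (intro conjI allI impI)
    show "coded_mem a b M (enc (i, x))" unfolding mem using D(3) by (rule imageI)
  next
    fix p assume p: "p < M"
    show "(\<exists>q r. a = q * Suc (Suc p * b) + Suc r \<and> r < Suc p * b) \<or>
     (\<exists>i x. p = enc (i, x) \<and> justified A R {z. coded_mem a b M (enc z)} i x)"
    proof (cases "coded_mem a b M p")
      case True
      then obtain k u where "p = enc (k, u)" "(k, u) \<in> D" unfolding mem by auto
      moreover from this D(2) have "justified A R D k u" unfolding is_derivation_def by simp
      ultimately show ?thesis unfolding D_eq by (intro disjI2 exI conjI)
    next
      case False
      with not_coded_mem[OF p] show ?thesis by (intro disjI1) simp
    qed
  qed
  then show "\<exists>a b M i. ?code a b M i" by (intro exI)
next
  assume "\<exists>a b M i. ?code a b M i"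
  then obtain a b M i where code: "?code a b M i" by (elim exE)
  define D :: "(nat \<times> 'a) set" where "D = {z. coded_mem a b M (enc z)}"
  have "is_derivation A R D"
    unfolding is_derivation_def
  proof (intro allI impI)
    fix k u assume "(k, u) \<in> D"
    then have c: "coded_mem a b M (enc (k, u))" by (simp only: D_def mem_Collect_eq)
    then have p: "enc (k, u) < M" by (simp only: coded_mem_def)
    with code have "(\<exists>q r. a = q * Suc (Suc (enc (k, u)) * b) + Suc r \<and> r < Suc (enc (k, u)) * b) \<or>
     (\<exists>i x. enc (k, u) = enc (i, x) \<and> justified A R D i x)"
      unfolding D_def by (elim conjE allE impE)
    then show "justified A R D k u"
    proof
      assume "\<exists>i x. enc (k, u) = enc (i, x) \<and> justified A R D i x"
      then show ?thesis by (simp only: enc_eq_iff prod.inject) blast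
    qed (use not_coded_mem[OF p] c in blast)
  qed
  moreover have "(i, x) \<in> D" using code by (simp only: D_def mem_Collect_eq)
  ultimately show "clos A R x" by (rule derivation_imp_clos)
qed

text \<open>Takes the place of recursion theorems: evaluation, execution steps, certificates and the
  sets of codes of recursive datatypes are all presented as derivable facts.\<close>

theorem sig_clos:
  assumes "sig A" "sig (\<lambda>p. R (fst p) (fst (snd p)) (snd (snd p)))"
  shows "sig (clos A R)"
proof -
  have R: "computable f \<Longrightarrow> computable g \<Longrightarrow> computable h \<Longrightarrow> sig (\<lambda>x. R (f x) (g x) (h x))" for f :: "'b::enc \<Rightarrow> 'a" and g h
    using sig_subst[OF computable_Pair[OF _ computable_Pair] assms(2), of f g h] by simp
  show ?thesis
    by (rule sig_cong[OF clos_iff_coded], unfold justified_def mem_Collect_eq)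
      (intro sig_intros sig_coded_mem R sig_subst[OF _ assms(1)])
qed

lemma computable1:
  assumes "sig (\<lambda>z. snd z = F (fst z))" "computable f"
  shows "computable (\<lambda>x. F (f x))"
  by (rule computable_comp[OF assms(2) computable_graph[OF assms(1)]])

lemma computable2:
  assumes "sig (\<lambda>z. snd z = F (fst (fst z)) (snd (fst z)))" "computable f" "computable g"
  shows "computable (\<lambda>x. F (f x) (g x))"
  using computable1[where F = "\<lambda>p. F (fst p) (snd p)", OF assms(1) computable_Pair[OF assms(2,3)]] by simp

lemma sig2:
  assumes "sig (\<lambda>z. R (fst z) (snd z))" "computable f" "computable g"
  shows "sig (\<lambda>x. R (f x) (g x))"
  using sig_subst[OF computable_Pair[OF assms(2,3)] assms(1)] by simp

lemma sig3:
  assumes "sig (\<lambda>z. R (fst z) (fst (snd z)) (snd (snd z)))" "computable f" "computable g" "computable h"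
  shows "sig (\<lambda>x. R (f x) (g x) (h x))"
  using sig_subst[OF computable_Pair[OF assms(2) computable_Pair[OF assms(3,4)]] assms(1)] by simp

section \<open>Integers, Booleans and rationals\<close>

instantiation int :: enc
begin
definition enc_int :: "int \<Rightarrow> nat" where "enc_int = int_encode"
instance
proof
  have "range int_encode = UNIV" by (rule surj_int_encode)
  then have "\<exists>x. n = int_encode x" for n by (metis rangeE UNIV_I)
  then show "sigma_env (\<lambda>e. \<exists>x::int. e 0 = enc x)"
    using se_eq[OF poly_0 poly_0] by (simp add: enc_int_def)
qed (simp add: enc_int_def inj_int_encode)
end

text \<open>\<open>int_encode\<close> sends k to 2k and -(k + 1) to 2k + 1. The two disjuncts are
  these cases, with the subtraction moved to the other side.\<close>

lemma int_eq_diff_iff: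
  "x = int a - int b \<longleftrightarrow> (\<exists>k. enc x = k + k \<and> k + b = a) \<or> (\<exists>k. enc x = Suc (k + k) \<and> Suc (a + k) = b)"
proof (cases "0 \<le> x")
  case True
  then obtain n where "x = int n" using nonneg_int_cases by blast
  then have "enc x = n + n" by (simp add: enc_int_def int_encode_def sum_encode_def)
  moreover from this have "enc x \<noteq> Suc (k + k)" for k by presburger
  ultimately show ?thesis using \<open>x = int n\<close> by auto
next
  case False
  then obtain n where "x = - int (Suc n)" by (metis negative_eq_positive int_cases linorder_not_le of_nat_0_le_iff)
  then have "enc x = Suc (n + n)" by (simp add: enc_int_def int_encode_def sum_encode_def)
  moreover from this have "enc x \<noteq> k + k" for k by presburger
  ultimately show ?thesis using \<open>x = - int (Suc n)\<close> by auto
qed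

lemma sig_int_eq_diff:
  "computable f \<Longrightarrow> computable g \<Longrightarrow> computable h \<Longrightarrow> sig (\<lambda>x. f x = int (g x) - int (h x))"
proof (rule sig3[where R = "\<lambda>x a b. x = int a - int b"])
  show "sig (\<lambda>z. fst z = int (fst (snd z)) - int (snd (snd z)))"
    unfolding int_eq_diff_iff by (intro sig_intros)
qed

lemma computable_int: "computable f \<Longrightarrow> computable (\<lambda>x. int (f x))"
  by (rule computable_encD)
    (simp add: enc_int_def int_encode_def sum_encode_def mult_2, intro sig_intros)

lemma int_as_diff: "\<exists>a b. x = int a - int b"
  using int_diff_cases by blast

text \<open>\<open>Q\<close> gives the same answer for every way of writing \<open>x\<close> and
  \<open>y\<close> as differences of naturals, so some representation is as good as all. Integer
  arithmetic thereby reduces to polynomials over the naturals.\<close>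

lemma ex_int_as_diff:
  assumes "\<And>a b c d. x = int a - int b \<Longrightarrow> y = int c - int d \<Longrightarrow> Q a b c d \<longleftrightarrow> P"
  shows "P \<longleftrightarrow> (\<exists>a b c d. x = int a - int b \<and> y = int c - int d \<and> Q a b c d)"
proof -
  obtain a b where x: "x = int a - int b" using int_as_diff by blast
  obtain c d where y: "y = int c - int d" using int_as_diff by blast
  show ?thesis
  proof
    assume P
    with assms[OF x y] x y
    show "\<exists>a b c d. x = int a - int b \<and> y = int c - int d \<and> Q a b c d" by blast
  next
    assume "\<exists>a b c d. x = int a - int b \<and> y = int c - int d \<and> Q a b c d"
    then show P by (elim exE conjE) (rule assms[THEN iffD1])
  qed
qed

lemma computable_minus_int: "computable f \<Longrightarrow> computable g \<Longrightarrow> computable (\<lambda>x. f x - g x :: int)"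
proof (rule computable2[where F = "\<lambda>x y. x - y"])
  have eq: "z = x - y \<longleftrightarrow> (\<exists>a b c d. x = int a - int b \<and> y = int c - int d \<and> z = int (a + d) - int (b + c))"
    for x y z :: int
    by (rule ex_int_as_diff) auto
  show "sig (\<lambda>z. snd z = (fst (fst z) - snd (fst z) :: int))"
    by (rule sig_cong[OF eq])
      (intro sig_ex sig_conj sig_int_eq_diff computable_fst computable_snd computable_id computable_add_nat)
qed

lemma computable_times_int: "computable f \<Longrightarrow> computable g \<Longrightarrow> computable (\<lambda>x. f x * g x :: int)"
proof (rule computable2[where F = "\<lambda>x y. x * y"])
  have m: "(int a - int b) * (int c - int d) = int (a * c + b * d) - int (a * d + b * c)" for a b c d
    by (simp add: algebra_simps)
  have eq: "z = x * y \<longleftrightarrow> (\<exists>a b c d. x = int a - int b \<and> y = int c - int d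
      \<and> z = int (a * c + b * d) - int (a * d + b * c))" for x y z :: int
    unfolding m[symmetric] by (rule ex_int_as_diff) auto
  show "sig (\<lambda>z. snd z = (fst (fst z) * snd (fst z) :: int))"
    unfolding eq by (intro sig_intros computable_minus_int computable_int)
qed

lemma computable_plus_int: "computable f \<Longrightarrow> computable g \<Longrightarrow> computable (\<lambda>x. f x + g x :: int)"
  using computable_minus_int[OF _ computable_minus_int[OF computable_const[of 0]], of f g] by simp

lemma sig_less_int: "computable f \<Longrightarrow> computable g \<Longrightarrow> sig (\<lambda>x. f x < (g x :: int))"
proof (rule sig2[where R = "\<lambda>x y. x < y"])
  have eq: "x < y \<longleftrightarrow> (\<exists>n. y = x + int (Suc n))" for x y :: int
    by (metis zless_iff_Suc_zadd)
  show "sig (\<lambda>z. fst z < (snd z :: int))"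
    unfolding eq by (intro sig_intros computable_plus_int computable_int)
qed

instantiation bool :: enc
begin
definition enc_bool :: "bool \<Rightarrow> nat" where "enc_bool b = (if b then 1 else 0)"
instance
proof
  have "sigma_env (\<lambda>e. e 0 = 0 \<or> e 0 = Suc 0)"
    by (intro se_disj se_eq poly_term.intros)
  then show "sigma_env (\<lambda>e. \<exists>x::bool. e 0 = enc x)"
    by (rule back_subst[of sigma_env]) (auto simp: enc_bool_def fun_eq_iff)
qed (auto simp: enc_bool_def inj_on_def split: if_splits)
end

text \<open>A predicate that is Sigma_1 together with its complement is decidable. Comparisons of
  rationals can then occur as truth values in the evaluation of Boolean expressions.\<close>

lemma computable_pred:
  assumes "sig P" "sig (\<lambda>x. \<not> P x)"
  shows "computable P"
proof (rule computable_graph, rule sig_cong)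
  show "(snd z = P (fst z)) \<longleftrightarrow> (P (fst z) \<and> snd z = True) \<or> (\<not> P (fst z) \<and> snd z = False)" for z
    by auto
  show "sig (\<lambda>z. (P (fst z) \<and> snd z = True) \<or> (\<not> P (fst z) \<and> snd z = False))"
    by (intro sig_intros sig_subst[OF _ assms(1)] sig_subst[OF _ assms(2)])
qed

lemma computable_Not: "computable f \<Longrightarrow> computable (\<lambda>x. \<not> f x)"
proof (rule computable1[where F = "\<lambda>x. \<not> x"])
  have eq: "y = (\<not> x) \<longleftrightarrow> (x = True \<and> y = False) \<or> (x = False \<and> y = True)" for x y by auto
  show "sig (\<lambda>z. snd z = (\<not> fst z))"
    unfolding eq by (intro sig_intros)
qed

lemma computable_conj: "computable f \<Longrightarrow> computable g \<Longrightarrow> computable (\<lambda>x. f x \<and> g x)"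
proof (rule computable_encD)
  have eq: "enc (a \<and> b) = enc a * enc b" for a b by (simp add: enc_bool_def)
  assume "computable f" "computable g"
  then show "computable (\<lambda>x. enc (f x \<and> g x))"
    unfolding eq by (intro sig_intros)
qed

lemma computable_disj: "computable f \<Longrightarrow> computable g \<Longrightarrow> computable (\<lambda>x. f x \<or> g x)"
  using computable_Not[OF computable_conj[OF computable_Not computable_Not], of f g] by simp

definition num :: "rat \<Rightarrow> int" where "num q = fst (quotient_of q)"
definition den :: "rat \<Rightarrow> int" where "den q = snd (quotient_of q)"

lemma quotient_of_num_den: "quotient_of q = (num q, den q)"
  by (simp add: num_def den_def)

lemma den_pos: "0 < den q"
  using quotient_of_denom_pos[OF quotient_of_num_den] .

lemma rat_num_den: "q = of_int (num q) / of_int (den q)"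
  using quotient_of_div[OF quotient_of_num_den] .

text \<open>Cross-multiplication compares the reduced fraction of \<open>q\<close> with an arbitrary
  one, so rational arithmetic can be described without computing greatest common divisors.\<close>

lemma rat_eq_div_iff: "d \<noteq> 0 \<Longrightarrow> q = of_int n / of_int d \<longleftrightarrow> num q * d = n * den q"
proof -
  assume "d \<noteq> 0"
  have "q = of_int n / of_int d \<longleftrightarrow> (of_int (num q) / of_int (den q) :: rat) = of_int n / of_int d"
    by (simp only: rat_num_den[symmetric])
  also have "\<dots> \<longleftrightarrow> (of_int (num q * d) :: rat) = of_int (n * den q)"
    using \<open>d \<noteq> 0\<close> den_pos[of q] by (simp add: frac_eq_eq)
  finally show ?thesis unfolding of_int_eq_iff .
qed

instantiation rat :: enc
begin
definition enc_rat :: "rat \<Rightarrow> nat" where "enc_rat = rat_code"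
instance
proof
  \<comment> \<open>Coprimality of numerator and denominator is expressed by a Bezout identity
    because that is existential.\<close>
  have "sig (\<lambda>n::nat. \<exists>a b. n = prod_encode (enc a, enc b) \<and> 0 < b \<and> (\<exists>u v::int. u * a + v * b = 1))"
    by (intro sig_intros sig_less_int computable_plus_int computable_times_int)
  moreover have "(\<exists>a b. n = prod_encode (enc a, enc b) \<and> 0 < b \<and> (\<exists>u v::int. u * a + v * b = 1))
      \<longleftrightarrow> (\<exists>q. n = rat_code q)" for n
  proof safe
    fix a b u v :: int
    assume "0 < b" "u * a + v * b = 1"
    then have "coprime a b" by (metis coprimeI dvd_add dvd_mult)
    with \<open>0 < b\<close> have "quotient_of (Fract a b) = (a, b)"
      by (simp add: quotient_of_Fract normalize_stable)
    then show "\<exists>q. prod_encode (enc a, enc b) = rat_code q"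
      by (intro exI[of _ "Fract a b"]) (simp add: rat_code_def enc_int_def)
  next
    fix q
    have "coprime (num q) (den q)" using quotient_of_coprime[OF quotient_of_num_den] .
    then have "\<exists>u v. u * num q + v * den q = 1" using bezout_int[of "num q" "den q"] by simp
    then show "\<exists>a b. rat_code q = prod_encode (enc a, enc b) \<and> 0 < b \<and> (\<exists>u v::int. u * a + v * b = 1)"
      using den_pos[of q] unfolding rat_code_def enc_int_def quotient_of_num_den fst_conv snd_conv by blast
  qed
  ultimately show "sigma_env (\<lambda>e. \<exists>q::rat. e 0 = enc q)"
    by (simp add: sig_def enc_rat_def)
  show "inj (enc :: rat \<Rightarrow> nat)"
  proof
    fix p q :: rat assume "enc p = enc q"
    then have "quotient_of p = quotient_of q"
      by (simp add: enc_rat_def rat_code_def prod_eq_iff inj_eq[OF inj_int_encode])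
    then show "p = q" by (simp add: quotient_of_inject)
  qed
qed
end

lemma enc_rat: "enc q = prod_encode (enc (num q), enc (den q))"
  by (simp add: enc_rat_def rat_code_def enc_int_def num_def den_def)

lemma computable_num: "computable f \<Longrightarrow> computable (\<lambda>x. num (f x))"
proof (rule computable1[where F = num])
  have eq: "n = num q \<longleftrightarrow> (\<exists>d::int. enc q = prod_encode (enc n, enc d))" for n q
    unfolding enc_rat by auto
  show "sig (\<lambda>z. snd z = num (fst z))" unfolding eq by (intro sig_intros)
qed

lemma computable_den: "computable f \<Longrightarrow> computable (\<lambda>x. den (f x))"
proof (rule computable1[where F = den])
  have eq: "d = den q \<longleftrightarrow> (\<exists>n::int. enc q = prod_encode (enc n, enc d))" for d q
    unfolding enc_rat by auto
  show "sig (\<lambda>z. snd z = den (fst z))" unfolding eq by (intro sig_intros)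
qed

lemmas rat_intros = sig_intros sig_less_int computable_plus_int computable_minus_int
  computable_times_int computable_int computable_num computable_den

lemma den_nonzero: "den q \<noteq> 0"
  using den_pos[of q] by simp

lemma computable_of_int: "computable f \<Longrightarrow> computable (\<lambda>x. of_int (f x) :: rat)"
proof (rule computable1[where F = of_int])
  have eq: "q = of_int n \<longleftrightarrow> num q * 1 = n * den q" for n and q :: rat
    using rat_eq_div_iff[of 1 q n] by simp
  show "sig (\<lambda>z. snd z = (of_int (fst z) :: rat))" unfolding eq by (intro rat_intros)
qed

lemma computable_plus_rat: "computable f \<Longrightarrow> computable g \<Longrightarrow> computable (\<lambda>x. f x + g x :: rat)"
proof (rule computable2[where F = "\<lambda>x y. x + y"])
  have s: "x + y = of_int (num x * den y + num y * den x) / of_int (den x * den y)" for x y :: rat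
  proof -
    have "x + y = of_int (num x) / of_int (den x) + of_int (num y) / of_int (den y)"
      by (simp only: rat_num_den[symmetric])
    then show ?thesis by (simp add: add_frac_eq den_nonzero)
  qed
  have eq: "z = x + y \<longleftrightarrow> num z * (den x * den y) = (num x * den y + num y * den x) * den z" for x y z :: rat
    unfolding s by (rule rat_eq_div_iff) (simp add: den_nonzero)
  show "sig (\<lambda>z. snd z = (fst (fst z) + snd (fst z) :: rat))"
    unfolding eq by (intro rat_intros)
qed

lemma computable_minus_rat: "computable f \<Longrightarrow> computable g \<Longrightarrow> computable (\<lambda>x. f x - g x :: rat)"
proof (rule computable2[where F = "\<lambda>x y. x - y"])
  have eq: "z = x - y \<longleftrightarrow> x = z + y" for x y z :: rat by auto
  show "sig (\<lambda>z. snd z = (fst (fst z) - snd (fst z) :: rat))"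
    unfolding eq by (intro sig_intros computable_plus_rat)
qed

lemma computable_times_rat: "computable f \<Longrightarrow> computable g \<Longrightarrow> computable (\<lambda>x. f x * g x :: rat)"
proof (rule computable2[where F = "\<lambda>x y. x * y"])
  have s: "x * y = of_int (num x * num y) / of_int (den x * den y)" for x y :: rat
  proof -
    have "x * y = (of_int (num x) / of_int (den x)) * (of_int (num y) / of_int (den y))"
      by (simp only: rat_num_den[symmetric])
    then show ?thesis by simp
  qed
  have eq: "z = x * y \<longleftrightarrow> num z * (den x * den y) = (num x * num y) * den z" for x y z :: rat
    unfolding s by (rule rat_eq_div_iff) (simp add: den_nonzero)
  show "sig (\<lambda>z. snd z = (fst (fst z) * snd (fst z) :: rat))"
    unfolding eq by (intro rat_intros)
qed

lemma sig_less_rat: "computable f \<Longrightarrow> computable g \<Longrightarrow> sig (\<lambda>x. f x < (g x :: rat))"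
proof (rule sig2[where R = "\<lambda>x y. x < y"])
  have eq: "x < y \<longleftrightarrow> num x * den y < num y * den x" for x y :: rat
    by (simp only: rat_less_code quotient_of_num_den Let_def prod.case mult.commute[of "den x"])
  show "sig (\<lambda>z. fst z < (snd z :: rat))"
    by (rule sig_cong[OF eq]) (intro rat_intros)
qed

lemma sig_le_rat: "computable f \<Longrightarrow> computable g \<Longrightarrow> sig (\<lambda>x. f x \<le> (g x :: rat))"
  unfolding le_less by (intro sig_disj sig_less_rat sig_eq)

lemma computable_divide_rat: "computable f \<Longrightarrow> computable g \<Longrightarrow> computable (\<lambda>x. f x / g x :: rat)"
proof (rule computable2[where F = "\<lambda>x y. x / y"])
  \<comment> \<open>Division by zero yields 0 in HOL and needs a case of its own; nonzero is spelled
    "less or greater" to stay positive.\<close>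
  have eq: "z = x / y \<longleftrightarrow> (y = 0 \<and> z = 0) \<or> ((y < 0 \<or> 0 < y) \<and> z * y = x)" for x y z :: rat
    by (cases "y = 0") (auto simp: eq_divide_eq neq_iff)
  show "sig (\<lambda>z. snd z = (fst (fst z) / snd (fst z) :: rat))"
    unfolding eq by (intro sig_intros sig_less_rat computable_times_rat)
qed

lemma computable_less_rat: "computable f \<Longrightarrow> computable g \<Longrightarrow> computable (\<lambda>x. f x < (g x :: rat))"
  by (rule computable_pred) (simp_all only: not_less sig_less_rat sig_le_rat)

lemma computable_eq_rat: "computable f \<Longrightarrow> computable g \<Longrightarrow> computable (\<lambda>x. f x = (g x :: rat))"
  by (rule computable_pred) (simp_all only: neq_iff sig_eq sig_less_rat sig_disj)

section \<open>Lists, expressions and programs\<close>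

lemma sigma_env_nat: "sig (P :: nat \<Rightarrow> bool) \<Longrightarrow> sigma_env (\<lambda>e. P (e 0))"
  by (simp add: sig_def)

primrec list_code :: "'a::enc list \<Rightarrow> nat" where
  "list_code [] = 0"
| "list_code (x # xs) = Suc (prod_encode (enc x, list_code xs))"

lemma list_code_inject: "list_code xs = list_code ys \<Longrightarrow> xs = ys"
proof (induction xs arbitrary: ys)
  case Nil then show ?case by (cases ys) auto
next
  case (Cons x xs) then show ?case by (cases ys) auto
qed

text \<open>Codes are generated bottom-up by the constructors, so the range is a least fixed point.
  Expressions and programs are treated in the same way.\<close>

lemma list_code_range:
  "clos (\<lambda>n. n = 0) (\<lambda>n y z. \<exists>u::'a::enc. n = Suc (prod_encode (enc u, y))) n
    \<longleftrightarrow> (\<exists>xs::'a list. n = list_code xs)" (is "clos ?A ?R n \<longleftrightarrow> _")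
proof
  show "clos ?A ?R n \<Longrightarrow> \<exists>xs::'a list. n = list_code xs"
  proof (induction rule: clos.induct)
    case (clos_ax x)
    then show ?case by (metis list_code.simps(1))
  next
    case (clos_step x y z)
    then show ?case by (metis list_code.simps(2))
  qed
  have "clos ?A ?R (list_code xs)" for xs :: "'a list"
  proof (induction xs)
    case Nil
    show ?case by (rule clos_ax) simp
  next
    case (Cons x xs)
    show ?case by (rule clos_step[OF _ Cons.IH Cons.IH]) auto
  qed
  then show "\<exists>xs::'a list. n = list_code xs \<Longrightarrow> clos ?A ?R n" by blast
qed

instantiation list :: (enc) enc
begin
definition enc_list :: "'a list \<Rightarrow> nat" where "enc_list = list_code"
instance
proof
  have "sig (\<lambda>n. \<exists>xs::'a list. n = list_code xs)"
    unfolding list_code_range[symmetric] by (intro sig_clos sig_intros)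
  then show "sigma_env (\<lambda>e. \<exists>xs::'a list. e 0 = enc xs)"
    unfolding enc_list_def by (rule sigma_env_nat)
qed (auto simp: enc_list_def inj_on_def list_code_inject)
end

lemma enc_list_simps [simp]: "enc [] = 0" "enc (x # xs) = Suc (prod_encode (enc x, enc xs))"
  by (simp_all add: enc_list_def)

lemma computable_Cons: "computable f \<Longrightarrow> computable g \<Longrightarrow> computable (\<lambda>x. f x # g x)"
  by (rule computable_encD) (simp only: enc_list_simps computable_Suc computable_prod_encode computable_enc)

lemma aexp_code_inject: "aexp_code a = aexp_code b \<Longrightarrow> a = b"
proof (induction a arbitrary: b)
  case (N q) then show ?case by (cases b) (auto simp: enc_rat_def[symmetric])
next
  case (V v) then show ?case by (cases b) auto
next
  case (Plus a1 a2) then show ?case by (cases b) auto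
next
  case (Minus a1 a2) then show ?case by (cases b) auto
next
  case (Times a1 a2) then show ?case by (cases b) auto
next
  case (Div a1 a2) then show ?case by (cases b) auto
qed

definition aexp_leaf :: "nat \<Rightarrow> bool" where
  "aexp_leaf n \<longleftrightarrow> (\<exists>q::rat. n = prod_encode (0, enc q)) \<or> (\<exists>v. n = prod_encode (1, v))"

definition aexp_node :: "nat \<Rightarrow> nat \<Rightarrow> nat \<Rightarrow> bool" where
  "aexp_node n y z \<longleftrightarrow> n = prod_encode (2, prod_encode (y, z)) \<or> n = prod_encode (3, prod_encode (y, z))
     \<or> n = prod_encode (4, prod_encode (y, z)) \<or> n = prod_encode (5, prod_encode (y, z))"

lemma aexp_code_range: "clos aexp_leaf aexp_node n \<longleftrightarrow> (\<exists>a. n = aexp_code a)"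
proof
  show "clos aexp_leaf aexp_node n \<Longrightarrow> \<exists>a. n = aexp_code a"
  proof (induction rule: clos.induct)
    case (clos_ax x)
    then show ?case unfolding aexp_leaf_def enc_rat_def by (elim disjE exE; simp only: aexp_code.simps(1,2)[symmetric]; blast)
  next
    case (clos_step x y z)
    then show ?case unfolding aexp_node_def by (elim disjE exE; simp only: aexp_code.simps(3-6)[symmetric]; blast)
  qed
  have "clos aexp_leaf aexp_node (aexp_code a)" for a
  proof (induction a)
    case (N q) show ?case by (rule clos_ax) (auto simp: aexp_leaf_def enc_rat_def)
  next
    case (V v) show ?case by (rule clos_ax) (auto simp: aexp_leaf_def)
  next
    case (Plus a b) show ?case by (rule clos_step[OF _ Plus.IH]) (simp add: aexp_node_def)
  next
    case (Minus a b) show ?case by (rule clos_step[OF _ Minus.IH]) (simp add: aexp_node_def)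
  next
    case (Times a b) show ?case by (rule clos_step[OF _ Times.IH]) (simp add: aexp_node_def)
  next
    case (Div a b) show ?case by (rule clos_step[OF _ Div.IH]) (simp add: aexp_node_def)
  qed
  then show "\<exists>a. n = aexp_code a \<Longrightarrow> clos aexp_leaf aexp_node n" by blast
qed

instantiation aexp :: enc
begin
definition enc_aexp :: "aexp \<Rightarrow> nat" where "enc_aexp = aexp_code"
instance
proof
  have "sig (\<lambda>n. \<exists>a. n = aexp_code a)"
    unfolding aexp_code_range[symmetric] aexp_leaf_def[abs_def] aexp_node_def[abs_def]
    by (intro sig_clos sig_intros)
  then show "sigma_env (\<lambda>e. \<exists>a::aexp. e 0 = enc a)"
    unfolding enc_aexp_def by (rule sigma_env_nat)
qed (auto simp: enc_aexp_def inj_on_def aexp_code_inject)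
end

lemma enc_aexp_simps:
  "enc (N q) = prod_encode (0, enc q)"
  "enc (V v) = prod_encode (1, v)"
  "enc (Plus a b) = prod_encode (2, prod_encode (enc a, enc b))"
  "enc (Minus a b) = prod_encode (3, prod_encode (enc a, enc b))"
  "enc (Times a b) = prod_encode (4, prod_encode (enc a, enc b))"
  "enc (Div a b) = prod_encode (5, prod_encode (enc a, enc b))"
  by (simp_all add: enc_aexp_def enc_rat_def)

lemma computable_aexp:
  "computable q \<Longrightarrow> computable (\<lambda>x. N (q x))"
  "computable v \<Longrightarrow> computable (\<lambda>x. V (v x))"
  "computable f \<Longrightarrow> computable g \<Longrightarrow> computable (\<lambda>x. Plus (f x) (g x))"
  "computable f \<Longrightarrow> computable g \<Longrightarrow> computable (\<lambda>x. Minus (f x) (g x))"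
  "computable f \<Longrightarrow> computable g \<Longrightarrow> computable (\<lambda>x. Times (f x) (g x))"
  "computable f \<Longrightarrow> computable g \<Longrightarrow> computable (\<lambda>x. Div (f x) (g x))"
  by (rule computable_encD,
      simp only: enc_aexp_simps computable_prod_encode computable_enc computable_const)+

lemma bexp_code_inject: "bexp_code a = bexp_code b \<Longrightarrow> a = b"
proof (induction a arbitrary: b)
  case (BConst c) then show ?case by (cases b) (auto split: if_splits)
next
  case (Less a1 a2) then show ?case by (cases b) (auto simp: aexp_code_inject)
next
  case (Eq a1 a2) then show ?case by (cases b) (auto simp: aexp_code_inject)
next
  case (Not a) then show ?case by (cases b) auto
next
  case (And a1 a2) then show ?case by (cases b) auto
next
  case (Or a1 a2) then show ?case by (cases b) auto
qed

text \<open>Comparisons count as leaves: their arguments are \<open>aexp\<close> codes, which are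
  already recognisable, and not facts of this fixed point.\<close>

definition bexp_leaf :: "nat \<Rightarrow> bool" where
  "bexp_leaf n \<longleftrightarrow> (\<exists>c::bool. n = prod_encode (0, enc c))
     \<or> (\<exists>(a::aexp) (b::aexp). n = prod_encode (1, prod_encode (enc a, enc b)))
     \<or> (\<exists>(a::aexp) (b::aexp). n = prod_encode (2, prod_encode (enc a, enc b)))"

definition bexp_node :: "nat \<Rightarrow> nat \<Rightarrow> nat \<Rightarrow> bool" where
  "bexp_node n y z \<longleftrightarrow> n = prod_encode (3, y)
     \<or> n = prod_encode (4, prod_encode (y, z)) \<or> n = prod_encode (5, prod_encode (y, z))"

lemma bexp_code_range: "clos bexp_leaf bexp_node n \<longleftrightarrow> (\<exists>b. n = bexp_code b)"
proof
  show "clos bexp_leaf bexp_node n \<Longrightarrow> \<exists>b. n = bexp_code b"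
  proof (induction rule: clos.induct)
    case (clos_ax x)
    then show ?case unfolding bexp_leaf_def enc_bool_def enc_aexp_def by (elim disjE exE; simp only: bexp_code.simps(1-3)[symmetric]; blast)
  next
    case (clos_step x y z)
    then show ?case unfolding bexp_node_def by (elim disjE exE; simp only: bexp_code.simps(4-6)[symmetric]; blast)
  qed
  have "clos bexp_leaf bexp_node (bexp_code b)" for b
  proof (induction b)
    case (BConst c) show ?case
      by (rule clos_ax, unfold bexp_leaf_def enc_bool_def, rule disjI1, rule exI[of _ c]) simp
  next
    case (Less a c) show ?case
      by (rule clos_ax, unfold bexp_leaf_def enc_aexp_def, rule disjI2, rule disjI1, rule exI[of _ a], rule exI[of _ c]) simp
  next
    case (Eq a c) show ?case
      by (rule clos_ax, unfold bexp_leaf_def enc_aexp_def, rule disjI2, rule disjI2, rule exI[of _ a], rule exI[of _ c]) simp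
  next
    case (Not b) show ?case
      by (rule clos_step[OF _ Not.IH Not.IH]) (simp add: bexp_node_def)
  next
    case (And a b) show ?case by (rule clos_step[OF _ And.IH]) (simp add: bexp_node_def)
  next
    case (Or a b) show ?case by (rule clos_step[OF _ Or.IH]) (simp add: bexp_node_def)
  qed
  then show "\<exists>b. n = bexp_code b \<Longrightarrow> clos bexp_leaf bexp_node n" by blast
qed

instantiation bexp :: enc
begin
definition enc_bexp :: "bexp \<Rightarrow> nat" where "enc_bexp = bexp_code"
instance
proof
  have "sig (\<lambda>n. \<exists>a. n = bexp_code a)"
    unfolding bexp_code_range[symmetric] bexp_leaf_def[abs_def] bexp_node_def[abs_def]
    by (intro sig_clos sig_intros)
  then show "sigma_env (\<lambda>e. \<exists>a::bexp. e 0 = enc a)"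
    unfolding enc_bexp_def by (rule sigma_env_nat)
qed (auto simp: enc_bexp_def inj_on_def bexp_code_inject)
end

lemma enc_bexp_simps:
  "enc (BConst c) = prod_encode (0, enc c)"
  "enc (Less a b) = prod_encode (1, prod_encode (enc a, enc b))"
  "enc (Eq a b) = prod_encode (2, prod_encode (enc a, enc b))"
  "enc (Not d) = prod_encode (3, enc d)"
  "enc (And d d') = prod_encode (4, prod_encode (enc d, enc d'))"
  "enc (Or d d') = prod_encode (5, prod_encode (enc d, enc d'))"
  by (simp_all add: enc_bexp_def enc_aexp_def enc_bool_def)

lemma computable_bexp:
  "computable c \<Longrightarrow> computable (\<lambda>x. BConst (c x))"
  "computable f \<Longrightarrow> computable g \<Longrightarrow> computable (\<lambda>x. Less (f x) (g x))"
  "computable f \<Longrightarrow> computable g \<Longrightarrow> computable (\<lambda>x. Eq (f x) (g x))"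
  "computable d \<Longrightarrow> computable (\<lambda>x. Not (d x))"
  "computable d \<Longrightarrow> computable d' \<Longrightarrow> computable (\<lambda>x. And (d x) (d' x))"
  "computable d \<Longrightarrow> computable d' \<Longrightarrow> computable (\<lambda>x. Or (d x) (d' x))"
  by (rule computable_encD,
      simp only: enc_bexp_simps computable_prod_encode computable_enc computable_const)+

lemma prog_code_inject: "prog_code P = prog_code Q \<Longrightarrow> P = Q"
proof (induction P arbitrary: Q)
  case Bot then show ?case by (cases Q) auto
next
  case (Assign v a) then show ?case by (cases Q) (auto simp: aexp_code_inject)
next
  case (Seq P1 P2) then show ?case by (cases Q) auto
next
  case (PChoice P1 a P2) then show ?case by (cases Q) (auto simp: aexp_code_inject)
next
  case (NChoice P1 P2) then show ?case by (cases Q) auto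
next
  case (While b P) then show ?case by (cases Q) (auto simp: bexp_code_inject)
qed

definition prog_leaf :: "nat \<Rightarrow> bool" where
  "prog_leaf n \<longleftrightarrow> n = prod_encode (0, 0)
     \<or> (\<exists>(v::nat) (a::aexp). n = prod_encode (1, prod_encode (v, enc a)))"

definition prog_node :: "nat \<Rightarrow> nat \<Rightarrow> nat \<Rightarrow> bool" where
  "prog_node n y z \<longleftrightarrow> n = prod_encode (2, prod_encode (y, z))
     \<or> (\<exists>p::aexp. n = prod_encode (3, prod_encode (y, prod_encode (enc p, z))))
     \<or> n = prod_encode (4, prod_encode (y, z))
     \<or> (\<exists>b::bexp. n = prod_encode (5, prod_encode (enc b, y)))"

lemma prog_code_range: "clos prog_leaf prog_node n \<longleftrightarrow> (\<exists>P. n = prog_code P)"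
proof
  show "clos prog_leaf prog_node n \<Longrightarrow> \<exists>P. n = prog_code P"
  proof (induction rule: clos.induct)
    case (clos_ax x)
    then show ?case unfolding prog_leaf_def enc_aexp_def by (elim disjE exE; simp only: prog_code.simps(1,2)[symmetric]; blast)
  next
    case (clos_step x y z)
    then show ?case unfolding prog_node_def enc_aexp_def enc_bexp_def by (elim disjE exE; simp only: prog_code.simps(3-6)[symmetric]; blast)
  qed
  have "clos prog_leaf prog_node (prog_code P)" for P
  proof (induction P)
    case Bot show ?case by (rule clos_ax) (simp add: prog_leaf_def)
  next
    case (Assign v a) show ?case
      by (rule clos_ax, unfold prog_leaf_def enc_aexp_def, rule disjI2, rule exI[of _ v], rule exI[of _ a]) simp
  next
    case (Seq P Q)
    show ?case by (rule clos_step[OF _ Seq.IH]) (simp add: prog_node_def)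
  next
    case (PChoice P a Q)
    show ?case
      by (rule clos_step[OF _ PChoice.IH], unfold prog_node_def enc_aexp_def,
          rule disjI2, rule disjI1, rule exI[of _ a]) simp
  next
    case (NChoice P Q)
    show ?case by (rule clos_step[OF _ NChoice.IH]) (simp add: prog_node_def)
  next
    case (While b P)
    show ?case
      by (rule clos_step[OF _ While.IH While.IH], unfold prog_node_def enc_bexp_def,
          rule disjI2, rule disjI2, rule disjI2, rule exI[of _ b]) simp
  qed
  then show "\<exists>P. n = prog_code P \<Longrightarrow> clos prog_leaf prog_node n" by blast
qed

instantiation prog :: enc
begin
definition enc_prog :: "prog \<Rightarrow> nat" where "enc_prog = prog_code"
instance
proof
  have "sig (\<lambda>n. \<exists>P. n = prog_code P)"
    unfolding prog_code_range[symmetric] prog_leaf_def[abs_def] prog_node_def[abs_def]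
    by (intro sig_clos sig_intros)
  then show "sigma_env (\<lambda>e. \<exists>P::prog. e 0 = enc P)"
    unfolding enc_prog_def by (rule sigma_env_nat)
qed (auto simp: enc_prog_def inj_on_def prog_code_inject)
end

lemma enc_prog_simps:
  "enc (Assign v a) = prod_encode (1, prod_encode (v, enc a))"
  "enc (Seq P Q) = prod_encode (2, prod_encode (enc P, enc Q))"
  "enc (PChoice P a Q) = prod_encode (3, prod_encode (enc P, prod_encode (enc a, enc Q)))"
  "enc (NChoice P Q) = prod_encode (4, prod_encode (enc P, enc Q))"
  "enc (While b P) = prod_encode (5, prod_encode (enc b, enc P))"
  by (simp_all add: enc_prog_def enc_aexp_def enc_bexp_def)

lemma computable_prog:
  "computable v \<Longrightarrow> computable a \<Longrightarrow> computable (\<lambda>x. Assign (v x) (a x))"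
  "computable P \<Longrightarrow> computable Q \<Longrightarrow> computable (\<lambda>x. Seq (P x) (Q x))"
  "computable P \<Longrightarrow> computable a \<Longrightarrow> computable Q \<Longrightarrow> computable (\<lambda>x. PChoice (P x) (a x) (Q x))"
  "computable P \<Longrightarrow> computable Q \<Longrightarrow> computable (\<lambda>x. NChoice (P x) (Q x))"
  "computable b \<Longrightarrow> computable P \<Longrightarrow> computable (\<lambda>x. While (b x) (P x))"
  by (rule computable_encD,
      simp only: enc_prog_simps computable_prod_encode computable_enc computable_const)+

section \<open>One execution step and certified lower bounds\<close>

text \<open>The part of a step that depends on neither the scheduler nor the accumulated
  probability. \<open>Tau\<close> carries the letters to append, since a probabilistic choice with
  probability at most 0 or at least 1 does not branch but still records a direction.\<close>

datatype action = Halt | Tau prog valuation "dir list" | Coin rat prog prog | Choose prog prog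

fun act :: "prog \<Rightarrow> valuation \<Rightarrow> action" where
  "act Bot \<eta> = Halt"
| "act (Assign v e) \<eta> = Tau Bot (\<eta>(v := aval e \<eta>)) []"
| "act (Seq P Q) \<eta> = (case act P \<eta> of
      Halt \<Rightarrow> Tau Q \<eta> []
    | Tau P' \<eta>' w \<Rightarrow> Tau (Seq P' Q) \<eta>' w
    | Coin p A B \<Rightarrow> Coin p (Seq A Q) (Seq B Q)
    | Choose A B \<Rightarrow> Choose (Seq A Q) (Seq B Q))"
| "act (PChoice A p B) \<eta> = (if aval p \<eta> \<le> 0 then Tau B \<eta> [Rp]
    else if 1 \<le> aval p \<eta> then Tau A \<eta> [Lp] else Coin (aval p \<eta>) A B)"
| "act (NChoice A B) \<eta> = Choose A B"
| "act (While b P) \<eta> = (if bval b \<eta> then Tau (Seq P (While b P)) \<eta> [] else Tau Bot \<eta> [])"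

lemma act_Halt_iff: "act P \<eta> = Halt \<longleftrightarrow> P = Bot"
  by (cases P) (auto split: action.split)

lemma act_Coin: "act P \<eta> = Coin p A B \<Longrightarrow> 0 < p \<and> p < 1"
  by (induction P arbitrary: A B) (auto split: if_splits action.splits)

text \<open>\<open>cert_nonpos\<close> lets a finite tree abandon any branch, even with a negative
  bound. At a choice both premises certify the same \<open>q\<close>, which therefore holds
  whichever branch is scheduled.\<close>

inductive cert :: "prog \<Rightarrow> valuation \<Rightarrow> rat \<Rightarrow> bool" where
  cert_nonpos: "q \<le> 0 \<Longrightarrow> cert P \<eta> q"
| cert_Halt: "q \<le> 1 \<Longrightarrow> act P \<eta> = Halt \<Longrightarrow> cert P \<eta> q"
| cert_Tau: "act P \<eta> = Tau P' \<eta>' w \<Longrightarrow> cert P' \<eta>' q \<Longrightarrow> cert P \<eta> q"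
| cert_Coin: "act P \<eta> = Coin p A B \<Longrightarrow> cert A \<eta> r \<Longrightarrow> cert B \<eta> s \<Longrightarrow> cert P \<eta> (p * r + (1 - p) * s)"
| cert_Choose: "act P \<eta> = Choose A B \<Longrightarrow> cert A \<eta> q \<Longrightarrow> cert B \<eta> q \<Longrightarrow> cert P \<eta> q"

section \<open>The certificate relation is recursively enumerable\<close>

text \<open>Assignments change one variable at a time and execution starts from zero, so lists
  denote all valuations that occur. One valuation has many lists; nothing below assumes
  uniqueness.\<close>

primrec store :: "(nat \<times> rat) list \<Rightarrow> valuation" where
  "store [] = (\<lambda>_. 0)"
| "store (x # l) = (store l)(fst x := snd x)"

definition store_leaf :: "(nat \<times> rat) list \<times> nat \<times> rat \<Rightarrow> bool" where
  "store_leaf t \<longleftrightarrow> (\<exists>v. t = ([], v, 0)) \<or> (\<exists>l v q. t = ((v, q) # l, v, q))"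

text \<open>A lookup passes over an entry for a different variable; the difference is stated without
  negation.\<close>

definition store_node ::
    "(nat \<times> rat) list \<times> nat \<times> rat \<Rightarrow> (nat \<times> rat) list \<times> nat \<times> rat \<Rightarrow> bool" where
  "store_node t y \<longleftrightarrow> (\<exists>l u r v q. t = ((u, r) # l, v, q) \<and> (u < v \<or> v < u) \<and> y = (l, v, q))"

lemma store_clos: "snd (snd t) = store (fst t) (fst (snd t)) \<longleftrightarrow> clos store_leaf (\<lambda>t y z. store_node t y) t"
proof
  have "clos store_leaf (\<lambda>t y z. store_node t y) (l, v, store l v)" for l v
  proof (induction l)
    case Nil
    show ?case by (rule clos_ax) (simp add: store_leaf_def)
  next
    case (Cons x l)
    show ?case
    proof (cases "v = fst x")
      case True
      then show ?thesis by (cases x) (auto intro!: clos_ax simp: store_leaf_def)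
    next
      case False
      then have "store_node (x # l, v, store (x # l) v) (l, v, store l v)"
        by (cases x) (auto simp: store_node_def)
      then show ?thesis by (rule clos_step[OF _ Cons.IH Cons.IH])
    qed
  qed
  then show "snd (snd t) = store (fst t) (fst (snd t)) \<Longrightarrow> clos store_leaf (\<lambda>t y z. store_node t y) t"
    by (metis prod.collapse)
next
  show "clos store_leaf (\<lambda>t y z. store_node t y) t \<Longrightarrow> snd (snd t) = store (fst t) (fst (snd t))"
    by (induction rule: clos.induct) (auto simp: store_leaf_def store_node_def)
qed

lemmas data_intros = sig_intros computable_Cons computable_aexp computable_bexp computable_prog
  computable_plus_rat computable_minus_rat computable_times_rat computable_divide_rat
  computable_less_rat computable_eq_rat computable_Not computable_conj computable_disj
  sig_less_rat sig_le_rat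

lemma computable_store: "computable l \<Longrightarrow> computable v \<Longrightarrow> computable (\<lambda>x. store (l x) (v x))"
proof (rule computable2[where F = store])
  have *: "sig (clos store_leaf (\<lambda>t y z. store_node t y))"
    unfolding store_leaf_def[abs_def] store_node_def
    by (intro sig_clos data_intros)
  have "sig (\<lambda>t. snd (snd t) = store (fst t) (fst (snd t)))"
    unfolding store_clos by (rule *)
  from sig_subst[OF _ this, of "\<lambda>z. (fst (fst z), snd (fst z), snd z)"]
  show "sig (\<lambda>z. snd z = store (fst (fst z)) (snd (fst z)))"
    by (simp add: computable_Pair computable_fst computable_snd computable_id)
qed

section \<open>Evaluation of expressions in a store\<close>

definition aval_leaf :: "aexp \<times> (nat \<times> rat) list \<times> rat \<Rightarrow> bool" where
  "aval_leaf t \<longleftrightarrow> (\<exists>l q. t = (N q, l, q)) \<or> (\<exists>l v. t = (V v, l, store l v))"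

definition aval_node :: "aexp \<times> (nat \<times> rat) list \<times> rat \<Rightarrow> aexp \<times> (nat \<times> rat) list \<times> rat
    \<Rightarrow> aexp \<times> (nat \<times> rat) list \<times> rat \<Rightarrow> bool" where
  "aval_node t y z \<longleftrightarrow> (\<exists>a b l q r. y = (a, l, q) \<and> z = (b, l, r) \<and>
     (t = (Plus a b, l, q + r) \<or> t = (Minus a b, l, q - r) \<or> t = (Times a b, l, q * r)
       \<or> t = (Div a b, l, q / r)))"

lemma aval_clos: "snd (snd t) = aval (fst t) (store (fst (snd t))) \<longleftrightarrow> clos aval_leaf aval_node t"
proof
  have "clos aval_leaf aval_node (a, l, aval a (store l))" for a l
  proof (induction a)
    case (N q)
    show ?case by (rule clos_ax) (simp add: aval_leaf_def)
  next
    case (V v)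
    show ?case by (rule clos_ax) (simp add: aval_leaf_def)
  next
    case (Plus a b)
    show ?case by (rule clos_step[OF _ Plus.IH]) (simp add: aval_node_def)
  next
    case (Minus a b)
    show ?case by (rule clos_step[OF _ Minus.IH]) (simp add: aval_node_def)
  next
    case (Times a b)
    show ?case by (rule clos_step[OF _ Times.IH]) (simp add: aval_node_def)
  next
    case (Div a b)
    show ?case by (rule clos_step[OF _ Div.IH]) (simp add: aval_node_def)
  qed
  then show "snd (snd t) = aval (fst t) (store (fst (snd t))) \<Longrightarrow> clos aval_leaf aval_node t"
    by (metis prod.collapse)
next
  show "clos aval_leaf aval_node t \<Longrightarrow> snd (snd t) = aval (fst t) (store (fst (snd t)))"
    by (induction rule: clos.induct) (auto simp: aval_leaf_def aval_node_def)
qed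

lemma computable_aval: "computable a \<Longrightarrow> computable l \<Longrightarrow> computable (\<lambda>x. aval (a x) (store (l x)))"
proof (rule computable2[where F = "\<lambda>a l. aval a (store l)"])
  have *: "sig (clos aval_leaf aval_node)"
    unfolding aval_leaf_def[abs_def] aval_node_def[abs_def]
    by (intro sig_clos data_intros computable_store)
  have "sig (\<lambda>t. snd (snd t) = aval (fst t) (store (fst (snd t))))"
    unfolding aval_clos by (rule *)
  from sig_subst[OF _ this, of "\<lambda>z. (fst (fst z), snd (fst z), snd z)"]
  show "sig (\<lambda>z. snd z = aval (fst (fst z)) (store (snd (fst z))))"
    by (simp add: computable_Pair computable_fst computable_snd computable_id)
qed

definition bval_leaf :: "bexp \<times> (nat \<times> rat) list \<times> bool \<Rightarrow> bool" where
  "bval_leaf t \<longleftrightarrow> (\<exists>l c. t = (BConst c, l, c))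
     \<or> (\<exists>a b l. t = (Less a b, l, aval a (store l) < aval b (store l)))
     \<or> (\<exists>a b l. t = (Eq a b, l, aval a (store l) = aval b (store l)))"

text \<open>The truth value is a component of the fact, so falsehood is derived positively and
  negation becomes an ordinary rule.\<close>

definition bval_node :: "bexp \<times> (nat \<times> rat) list \<times> bool \<Rightarrow> bexp \<times> (nat \<times> rat) list \<times> bool
    \<Rightarrow> bexp \<times> (nat \<times> rat) list \<times> bool \<Rightarrow> bool" where
  "bval_node t y z \<longleftrightarrow> (\<exists>a b l c d. y = (a, l, c) \<and> z = (b, l, d) \<and>
     (t = (Not a, l, \<not> c) \<or> t = (And a b, l, c \<and> d) \<or> t = (Or a b, l, c \<or> d)))"

lemma bval_clos: "snd (snd t) = bval (fst t) (store (fst (snd t))) \<longleftrightarrow> clos bval_leaf bval_node t"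
proof
  have "clos bval_leaf bval_node (b, l, bval b (store l))" for b l
  proof (induction b)
    case (BConst c)
    show ?case by (rule clos_ax) (simp add: bval_leaf_def)
  next
    case (Less a b)
    show ?case by (rule clos_ax) (simp add: bval_leaf_def)
  next
    case (Eq a b)
    show ?case by (rule clos_ax) (simp add: bval_leaf_def)
  next
    case (Not a)
    show ?case by (rule clos_step[OF _ Not.IH Not.IH]) (simp add: bval_node_def)
  next
    case (And a b)
    show ?case by (rule clos_step[OF _ And.IH]) (simp add: bval_node_def)
  next
    case (Or a b)
    show ?case by (rule clos_step[OF _ Or.IH]) (simp add: bval_node_def)
  qed
  then show "snd (snd t) = bval (fst t) (store (fst (snd t))) \<Longrightarrow> clos bval_leaf bval_node t"
    by (cases t) (simp only: fst_conv snd_conv)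
next
  show "clos bval_leaf bval_node t \<Longrightarrow> snd (snd t) = bval (fst t) (store (fst (snd t)))"
    by (induction rule: clos.induct) (auto simp: bval_leaf_def bval_node_def)
qed

lemma computable_bval: "computable b \<Longrightarrow> computable l \<Longrightarrow> computable (\<lambda>x. bval (b x) (store (l x)))"
proof (rule computable2[where F = "\<lambda>b l. bval b (store l)"])
  have *: "sig (clos bval_leaf bval_node)"
    unfolding bval_leaf_def[abs_def] bval_node_def[abs_def]
    by (intro sig_clos data_intros computable_aval)
  have "sig (\<lambda>t. snd (snd t) = bval (fst t) (store (fst (snd t))))"
    unfolding bval_clos by (rule *)
  from sig_subst[OF _ this, of "\<lambda>z. (fst (fst z), snd (fst z), snd z)"]
  show "sig (\<lambda>z. snd z = bval (fst (fst z)) (store (snd (fst z))))"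
    by (simp add: computable_Pair computable_fst computable_snd computable_id)
qed

text \<open>A tuple \<open>(P, l, k, p, A, B, l')\<close> describes the step of \<open>P\<close> in the store \<open>l\<close>: to \<open>A = B\<close> for
  \<open>k = 0\<close>, a coin flip with probability \<open>p\<close> for \<open>k = 1\<close>, a nondeterministic choice for \<open>k = 2\<close>.\<close>

type_synonym move =
  "prog \<times> (nat \<times> rat) list \<times> nat \<times> rat \<times> prog \<times> prog \<times> (nat \<times> rat) list"

text \<open>A failing loop guard is an equation with \<open>False\<close> between computable
  functions, as \<open>sig\<close> offers no negation.\<close>

definition move_leaf :: "move \<Rightarrow> bool" where
  "move_leaf t \<longleftrightarrow>
     (\<exists>v e l. t = (Assign v e, l, 0, 0, Bot, Bot, (v, aval e (store l)) # l))
   \<or> (\<exists>Q l. t = (Seq Bot Q, l, 0, 0, Q, Q, l))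
   \<or> (\<exists>A e B l. aval e (store l) \<le> 0 \<and> t = (PChoice A e B, l, 0, 0, B, B, l))
   \<or> (\<exists>A e B l. 1 \<le> aval e (store l) \<and> t = (PChoice A e B, l, 0, 0, A, A, l))
   \<or> (\<exists>A e B l. 0 < aval e (store l) \<and> aval e (store l) < 1 \<and>
        t = (PChoice A e B, l, 1, aval e (store l), A, B, l))
   \<or> (\<exists>A B l. t = (NChoice A B, l, 2, 0, A, B, l))
   \<or> (\<exists>b P l. bval b (store l) = True \<and>
        t = (While b P, l, 0, 0, Seq P (While b P), Seq P (While b P), l))
   \<or> (\<exists>b P l. bval b (store l) = False \<and> t = (While b P, l, 0, 0, Bot, Bot, l))"

text \<open>Only a \<open>Seq\<close> whose first component can still move inherits its step from a
  subprogram; \<open>Seq Bot Q\<close> is an axiom.\<close>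

definition move_node :: "move \<Rightarrow> move \<Rightarrow> bool" where
  "move_node t y \<longleftrightarrow> (\<exists>P l k p A B l' Q.
     y = (P, l, k, p, A, B, l') \<and> t = (Seq P Q, l, k, p, Seq A Q, Seq B Q, l'))"

abbreviation "move \<equiv> clos move_leaf (\<lambda>t y z. move_node t y)"

lemma sig_move: "sig move"
  unfolding move_leaf_def[abs_def] move_node_def
  by (intro sig_clos data_intros computable_aval computable_bval)

lemma move_sound:
  "move t \<Longrightarrow> (case t of (P, l, k, p, A, B, l') \<Rightarrow>
     k = 0 \<and> A = B \<and> (\<exists>w. act P (store l) = Tau A (store l') w)
   \<or> k = 1 \<and> act P (store l) = Coin p A B \<and> l' = l
   \<or> k = 2 \<and> act P (store l) = Choose A B \<and> l' = l)"
proof (induction rule: clos.induct)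
  case (clos_ax t)
  then show ?case unfolding move_leaf_def by (elim disjE exE) auto
next
  case (clos_step t y z)
  from clos_step.hyps(1) show ?case
    unfolding move_node_def using clos_step.IH(1) by (elim exE) auto
qed

lemma move_Seq:
  "move (P, l, k, p, A, B, l') \<Longrightarrow> move (Seq P Q, l, k, p, Seq A Q, Seq B Q, l')"
  by (rule clos_step[of "\<lambda>t y z. move_node t y"]) (auto simp: move_node_def)

text \<open>\<open>act\<close> returns a valuation, from which no list can be read off; hence after
  \<open>Tau\<close> only some list denoting it is claimed. The other two kinds of step keep the
  store, and \<open>l\<close> itself serves.\<close>

lemma move_complete:
  "(\<forall>A \<eta>' w. act P (store l) = Tau A \<eta>' w \<longrightarrow> (\<exists>l'. store l' = \<eta>' \<and> move (P, l, 0, 0, A, A, l')))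
   \<and> (\<forall>p A B. act P (store l) = Coin p A B \<longrightarrow> move (P, l, 1, p, A, B, l))
   \<and> (\<forall>A B. act P (store l) = Choose A B \<longrightarrow> move (P, l, 2, 0, A, B, l))"
proof (induction P)
  case Bot
  show ?case by simp
next
  case (Assign v e)
  have "move (Assign v e, l, 0, 0, Bot, Bot, (v, aval e (store l)) # l)"
    by (rule clos_ax) (simp add: move_leaf_def)
  then show ?case by (auto intro!: exI[of _ "(v, aval e (store l)) # l"])
next
  case (Seq P Q)
  show ?case
  proof (cases "act P (store l)")
    case Halt
    then have "P = Bot" by (simp add: act_Halt_iff)
    moreover have "move (Seq Bot Q, l, 0, 0, Q, Q, l)"
      by (rule clos_ax) (simp add: move_leaf_def)
    ultimately show ?thesis by auto
  next
    case (Tau A \<eta>' w)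
    with Seq.IH(1) obtain l' where "store l' = \<eta>'" "move (P, l, 0, 0, A, A, l')" by blast
    with Tau show ?thesis using move_Seq by auto
  next
    case (Coin p A B)
    with Seq.IH(1) have "move (P, l, 1, p, A, B, l)" by blast
    with Coin show ?thesis using move_Seq by auto
  next
    case (Choose A B)
    with Seq.IH(1) have "move (P, l, 2, 0, A, B, l)" by blast
    with Choose show ?thesis using move_Seq by auto
  qed
next
  case (PChoice A e B)
  consider "aval e (store l) \<le> 0" | "1 \<le> aval e (store l)"
    | "0 < aval e (store l)" "aval e (store l) < 1" by linarith
  then show ?case
  proof cases
    case 1
    then have "move (PChoice A e B, l, 0, 0, B, B, l)"
      by (intro clos_ax) (simp add: move_leaf_def)
    with 1 show ?thesis by auto
  next
    case 2
    then have "move (PChoice A e B, l, 0, 0, A, A, l)"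
      by (intro clos_ax) (simp add: move_leaf_def)
    with 2 show ?thesis by auto
  next
    case 3
    then have "move (PChoice A e B, l, 1, aval e (store l), A, B, l)"
      by (intro clos_ax) (simp add: move_leaf_def)
    with 3 show ?thesis by auto
  qed
next
  case (NChoice A B)
  have "move (NChoice A B, l, 2, 0, A, B, l)"
    by (rule clos_ax) (simp add: move_leaf_def)
  then show ?case by simp
next
  case (While b P)
  show ?case
  proof (cases "bval b (store l)")
    case True
    then have "move (While b P, l, 0, 0, Seq P (While b P), Seq P (While b P), l)"
      by (intro clos_ax) (simp add: move_leaf_def)
    with True show ?thesis by auto
  next
    case False
    then have "move (While b P, l, 0, 0, Bot, Bot, l)"
      by (intro clos_ax) (simp add: move_leaf_def)
    with False show ?thesis by auto
  qed
qed

definition cert_leaf :: "prog \<times> (nat \<times> rat) list \<times> rat \<Rightarrow> bool" where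
  "cert_leaf t \<longleftrightarrow> (\<exists>P l q. t = (P, l, q) \<and> (q \<le> 0 \<or> P = Bot \<and> q \<le> 1))"

text \<open>For \<open>k = 0\<close> a \<open>move\<close> has \<open>A = B\<close>, so the two
  premises coincide and the rule for \<open>Tau\<close> is padded to two premises.\<close>

definition cert_node :: "prog \<times> (nat \<times> rat) list \<times> rat \<Rightarrow> prog \<times> (nat \<times> rat) list \<times> rat
    \<Rightarrow> prog \<times> (nat \<times> rat) list \<times> rat \<Rightarrow> bool" where
  "cert_node t y z \<longleftrightarrow> (\<exists>P l k p A B l' q r s. t = (P, l, q) \<and> y = (A, l', r) \<and> z = (B, l', s)
     \<and> move (P, l, k, p, A, B, l')
     \<and> ((k = 0 \<or> k = 2) \<and> r = q \<and> s = q \<or> k = 1 \<and> q = p * r + (1 - p) * s))"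

lemma cert_clos: "cert P (store l) q \<longleftrightarrow> clos cert_leaf cert_node (P, l, q)"
proof
  show "cert P (store l) q \<Longrightarrow> clos cert_leaf cert_node (P, l, q)"
  proof (induction P "store l" q arbitrary: l rule: cert.induct)
    case (cert_nonpos q P)
    then show ?case by (intro clos_ax) (simp add: cert_leaf_def)
  next
    case (cert_Halt q P)
    then show ?case by (intro clos_ax) (simp add: cert_leaf_def act_Halt_iff)
  next
    case (cert_Tau P P' \<eta>' w q)
    then obtain l' where l': "store l' = \<eta>'" "move (P, l, 0, 0, P', P', l')"
      using move_complete[of P l] by blast
    with cert_Tau.hyps(3)[of l'] have *: "clos cert_leaf cert_node (P', l', q)" by simp
    from l'(2) have "cert_node (P, l, q) (P', l', q) (P', l', q)"
      unfolding cert_node_def by auto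
    then show ?case using * * by (rule clos_step)
  next
    case (cert_Coin P p A B r s)
    then have "move (P, l, 1, p, A, B, l)" using move_complete[of P l] by blast
    then have "cert_node (P, l, p * r + (1 - p) * s) (A, l, r) (B, l, s)"
      unfolding cert_node_def by auto
    then show ?case using cert_Coin.hyps(3,5)[OF refl] by (rule clos_step)
  next
    case (cert_Choose P A B q)
    then have "move (P, l, 2, 0, A, B, l)" using move_complete[of P l] by blast
    then have "cert_node (P, l, q) (A, l, q) (B, l, q)"
      unfolding cert_node_def by auto
    then show ?case using cert_Choose.hyps(3,5)[OF refl] by (rule clos_step)
  qed
next
  have "clos cert_leaf cert_node t \<Longrightarrow> cert (fst t) (store (fst (snd t))) (snd (snd t))" for t
  proof (induction rule: clos.induct)
    case (clos_ax t)
    then show ?case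
      unfolding cert_leaf_def by (auto intro: cert_nonpos cert_Halt)
  next
    case (clos_step t y z)
    from clos_step.hyps(1) obtain P l k p A B l' q r s where *: "t = (P, l, q)" "y = (A, l', r)"
      "z = (B, l', s)" "move (P, l, k, p, A, B, l')"
      "(k = 0 \<or> k = 2) \<and> r = q \<and> s = q \<or> k = 1 \<and> q = p * r + (1 - p) * s"
      unfolding cert_node_def by (elim exE conjE)
    from move_sound[OF *(4)] *(5) clos_step.IH show ?case
      unfolding *(1-3) by (auto intro: cert_Tau cert_Coin cert_Choose)
  qed
  from this[of "(P, l, q)"] show "clos cert_leaf cert_node (P, l, q) \<Longrightarrow> cert P (store l) q" by simp
qed

lemma sig_cert:
  "computable P \<Longrightarrow> computable l \<Longrightarrow> computable q \<Longrightarrow> sig (\<lambda>x. cert (P x) (store (l x)) (q x))"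
proof (rule sig3[where R = "\<lambda>P l q. cert P (store l) q"])
  have "sig (clos cert_leaf cert_node)"
    unfolding cert_leaf_def[abs_def] cert_node_def[abs_def]
    by (intro sig_clos data_intros sig_subst[OF _ sig_move])
  then show "sig (\<lambda>t. cert (fst t) (store (fst (snd t))) (snd (snd t)))"
    unfolding cert_clos by simp
qed

lemma Pi02_cert:
  "Pi02 (prog_code ` {P. \<forall>x::nat. cert P (\<lambda>_. 0) (1 - 1 / (of_nat x + 1))})"
proof (rule sigma_env_Pi02)
  \<comment> \<open>\<open>of_int (int x)\<close> replaces \<open>of_nat x\<close>, and
    \<open>store []\<close> the zero valuation, since these forms are covered by the computability
    rules.\<close>
  let ?R = "\<lambda>z::nat \<times> nat. \<exists>P::prog. fst z = enc P \<and>
    cert P (store []) (1 - 1 / (of_int (int (snd z)) + 1))"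
  have R: "sig ?R"
    by (intro sig_ex sig_conj sig_eq sig_cert data_intros computable_of_int computable_int)
  show "sigma_env (\<lambda>e. \<exists>p. p = prod_encode (e 0, e 1) \<and> (\<exists>z. p = enc z \<and> ?R z))"
    by (intro se_exI se_conj se_prod_encode se_sig[OF R])
  fix n
  have "n \<in> prog_code ` {P. \<forall>x::nat. cert P (\<lambda>_. 0) (1 - 1 / (of_nat x + 1))} \<longleftrightarrow>
     (\<forall>x::nat. \<exists>P. n = enc P \<and> cert P (\<lambda>_. 0) (1 - 1 / (of_nat x + 1)))"
  proof
    assume *: "\<forall>x::nat. \<exists>P. n = enc P \<and> cert P (\<lambda>_. 0) (1 - 1 / (of_nat x + 1))"
    \<comment> \<open>The program is read off at x = 0; injectivity of \<open>enc\<close> makes it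
      the same for every x.\<close>
    from spec[OF *, of 0] obtain P :: prog where P: "n = enc P" by (elim exE conjE)
    with * have "\<forall>x::nat. cert P (\<lambda>_. 0) (1 - 1 / (of_nat x + 1))"
      by simp
    with P show "n \<in> prog_code ` {P. \<forall>x::nat. cert P (\<lambda>_. 0) (1 - 1 / (of_nat x + 1))}"
      unfolding enc_prog_def by blast
  qed (auto simp: enc_prog_def)
  moreover have "(\<exists>p. p = prod_encode (n, x) \<and> (\<exists>z. p = enc z \<and> ?R z)) \<longleftrightarrow>
     (\<exists>P. n = enc P \<and> cert P (\<lambda>_. 0) (1 - 1 / (of_nat x + 1)))" for x
    by (simp add: enc_prod_def)
  ultimately show "n \<in> prog_code ` {P. \<forall>x::nat. cert P (\<lambda>_. 0) (1 - 1 / (of_nat x + 1))} \<longleftrightarrow>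
    (\<forall>x. \<exists>p. p = prod_encode ((case_nat n (case_nat x (\<lambda>_. 0))) 0, (case_nat n (case_nat x (\<lambda>_. 0))) 1)
       \<and> (\<exists>z. p = enc z \<and> ?R z))"
    by simp
qed

section \<open>Termination probability after finitely many steps\<close>

text \<open>The empty set for an answer other than \<open>Ln\<close> and \<open>Rn\<close> mirrors
  \<open>step\<close>, which has no rule there; agreement with \<open>step\<close> thus holds for
  arbitrary \<open>f\<close>.\<close>

definition succs :: "(dir list \<Rightarrow> dir) \<Rightarrow> state \<Rightarrow> state set" where
  "succs f s = (case s of (P, \<eta>, a, w) \<Rightarrow> (case act P \<eta> of
      Halt \<Rightarrow> {}
    | Tau P' \<eta>' u \<Rightarrow> {(P', \<eta>', a, w @ u)}
    | Coin p A B \<Rightarrow> {(A, \<eta>, a * p, w @ [Lp]), (B, \<eta>, a * (1 - p), w @ [Rp])}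
    | Choose A B \<Rightarrow> (if f w = Ln then {(A, \<eta>, a, w @ [Ln])}
        else if f w = Rn then {(B, \<eta>, a, w @ [Rn])} else {})))"

lemma step_imp_succs: "step f s s' \<Longrightarrow> s' \<in> succs f s"
proof (induction rule: step.induct)
  case (seq P1 \<eta> a w P1' \<eta>' a' w' P2)
  then show ?case by (auto simp: succs_def split: action.splits if_splits)
qed (auto simp: succs_def)

lemma succs_imp_step: "s' \<in> succs f (P, \<eta>, a, w) \<Longrightarrow> step f (P, \<eta>, a, w) s'"
proof (induction P arbitrary: s')
  case Bot
  then show ?case by (simp add: succs_def)
next
  case (Assign v e)
  then show ?case by (auto simp: succs_def intro: step.intros)
next
  case (Seq P Q)
  have lift: "step f (Seq P Q, \<eta>, a, w) (Seq P' Q, \<eta>', a', w')"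
    if "(P', \<eta>', a', w') \<in> succs f (P, \<eta>, a, w)" for P' \<eta>' a' w'
    using Seq.IH(1)[OF that] by (rule step.seq)
  show ?case
  proof (cases "act P \<eta>")
    case Halt
    with Seq.prems show ?thesis by (auto simp: succs_def act_Halt_iff intro: step.intros)
  next
    case (Tau P' \<eta>' u)
    with Seq.prems lift[of P' \<eta>' a "w @ u"] show ?thesis by (auto simp: succs_def)
  next
    case (Coin p A B)
    with Seq.prems lift[of A \<eta> "a * p" "w @ [Lp]"] lift[of B \<eta> "a * (1 - p)" "w @ [Rp]"]
    show ?thesis by (auto simp: succs_def)
  next
    case (Choose A B)
    with Seq.prems lift[of A \<eta> a "w @ [Ln]"] lift[of B \<eta> a "w @ [Rn]"]
    show ?thesis by (auto simp: succs_def split: if_splits)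
  qed
next
  case (PChoice A e B)
  then show ?case by (auto simp: succs_def not_le intro: step.intros split: if_splits)
next
  case (NChoice A B)
  then show ?case by (auto simp: succs_def intro: step.intros split: if_splits)
next
  case (While b P)
  then show ?case by (auto simp: succs_def intro: step.intros split: if_splits)
qed

lemma step_iff_succs: "step f s s' \<longleftrightarrow> s' \<in> succs f s"
  by (cases s) (auto intro: step_imp_succs succs_imp_step)

text \<open>\<open>n\<close> bounds the number of steps instead of fixing it: terminal states are
  kept, so the sets increase with \<open>n\<close>.\<close>

primrec terminals :: "(dir list \<Rightarrow> dir) \<Rightarrow> nat \<Rightarrow> state \<Rightarrow> state set" where
  "terminals f 0 s = (if terminal s then {s} else {})"
| "terminals f (Suc n) s = (if terminal s then {s} else (\<Union>s'\<in>succs f s. terminals f n s'))"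

text \<open>The probability accumulated before reaching the configuration is factored out, so the
  recursion can restart from any configuration.\<close>

primrec mass :: "(dir list \<Rightarrow> dir) \<Rightarrow> nat \<Rightarrow> prog \<Rightarrow> valuation \<Rightarrow> dir list \<Rightarrow> real" where
  "mass f 0 P \<eta> w = (if P = Bot then 1 else 0)"
| "mass f (Suc n) P \<eta> w = (case act P \<eta> of
      Halt \<Rightarrow> 1
    | Tau P' \<eta>' u \<Rightarrow> mass f n P' \<eta>' (w @ u)
    | Coin p A B \<Rightarrow> of_rat p * mass f n A \<eta> (w @ [Lp]) + (1 - of_rat p) * mass f n B \<eta> (w @ [Rp])
    | Choose A B \<Rightarrow> if f w = Ln then mass f n A \<eta> (w @ [Ln]) else mass f n B \<eta> (w @ [Rn]))"

lemma terminal_iff [simp]: "terminal (P, \<eta>, a, w) \<longleftrightarrow> P = Bot"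
  by (simp add: terminal_def)

text \<open>Histories only grow, so runs separated by a coin can never meet in the same
  state.\<close>

lemma terminals_history:
  "s \<in> terminals f n (P, \<eta>, a, w) \<Longrightarrow> \<exists>u. snd (snd (snd s)) = w @ u"
proof (induction n arbitrary: P \<eta> a w)
  case 0
  then show ?case by (auto split: if_splits)
next
  case (Suc n)
  show ?case
  proof (cases "P = Bot")
    case True
    with Suc.prems show ?thesis by simp
  next
    case False
    with Suc.prems obtain P' \<eta>' a' u where
      "(P', \<eta>', a', u) \<in> succs f (P, \<eta>, a, w)" "s \<in> terminals f n (P', \<eta>', a', u)" by auto
    moreover from this(1) have "\<exists>v. u = w @ v"
      by (auto simp: succs_def split: action.splits if_splits)
    ultimately show ?thesis using Suc.IH[of P' \<eta>' a' u] by auto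
  qed
qed

lemma of_rat_Coin: "act P \<eta> = Coin p A B \<Longrightarrow> 0 < (of_rat p :: real) \<and> (of_rat p :: real) < 1"
  using act_Coin[of P \<eta> p A B] by simp

lemma mass_bounds: "0 \<le> mass f n P \<eta> w \<and> mass f n P \<eta> w \<le> 1"
proof (induction n arbitrary: P \<eta> w)
  case 0
  then show ?case by simp
next
  case (Suc n)
  show ?case
  proof (cases "act P \<eta>")
    case (Coin p A B)
    let ?x = "mass f n A \<eta> (w @ [Lp])" and ?y = "mass f n B \<eta> (w @ [Rp])" and ?p = "of_rat p :: real"
    have p: "0 < ?p" "?p < 1" using of_rat_Coin[OF Coin] by auto
    have "0 \<le> ?p * ?x" "0 \<le> (1 - ?p) * ?y" using Suc.IH p by simp_all
    moreover have "?p * ?x \<le> ?p * 1" "(1 - ?p) * ?y \<le> (1 - ?p) * 1"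
      using Suc.IH p by (intro mult_left_mono; simp)+
    then have "?p * ?x + (1 - ?p) * ?y \<le> ?p * 1 + (1 - ?p) * 1" by (rule add_mono)
    ultimately show ?thesis unfolding mass.simps Coin action.case by simp
  qed (simp_all add: Suc.IH)
qed

lemma mass_mono: "mass f n P \<eta> w \<le> mass f (Suc n) P \<eta> w"
proof (induction n arbitrary: P \<eta> w)
  case 0
  show ?case
  proof (cases "P = Bot")
    case True
    then show ?thesis by simp
  next
    case False
    then show ?thesis using mass_bounds[of f "Suc 0" P \<eta> w] by (simp del: mass.simps(2))
  qed
next
  case (Suc n)
  show ?case
  proof (cases "act P \<eta>")
    case (Coin p A B)
    then show ?thesis using of_rat_Coin[OF Coin] Suc.IH
      unfolding mass.simps(2)[of f n P] mass.simps(2)[of f "Suc n" P] Coin action.case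
      by (intro add_mono mult_left_mono) auto
  next
    case (Tau P' \<eta>' u)
    then show ?thesis using Suc.IH
      unfolding mass.simps(2)[of f n P] mass.simps(2)[of f "Suc n" P] Tau action.case by blast
  next
    case (Choose A B)
    then show ?thesis using Suc.IH
      unfolding mass.simps(2)[of f n P] mass.simps(2)[of f "Suc n" P] Choose action.case by simp
  qed simp
qed

lemma mass_le: "m \<le> n \<Longrightarrow> mass f m P \<eta> w \<le> mass f n P \<eta> w"
  by (rule lift_Suc_mono_le[of "\<lambda>n. mass f n P \<eta> w"]) (rule mass_mono)

lemma terminals_mono: "terminals f n s \<subseteq> terminals f (Suc n) s"
proof (induction n arbitrary: s)
  case 0
  show ?case by auto
next
  case (Suc n)
  show ?case
  proof (cases "terminal s")
    case False
    then show ?thesis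
      unfolding terminals.simps(2)[of f n s] terminals.simps(2)[of f "Suc n" s]
      using Suc.IH by (simp only: if_False) (rule UN_mono, auto)
  qed simp
qed

lemma terminals_le: "m \<le> n \<Longrightarrow> terminals f m s \<subseteq> terminals f n s"
  by (rule lift_Suc_mono_le[of "\<lambda>n. terminals f n s"]) (rule terminals_mono)

lemma finite_terminals: "finite (terminals f n s)"
proof (induction n arbitrary: s)
  case (Suc n)
  have "finite (succs f s)" by (cases s) (simp add: succs_def split: action.split)
  with Suc.IH show ?case by simp
qed simp

abbreviation weight :: "state \<Rightarrow> ennreal" where
  "weight s \<equiv> ennreal (real_of_rat (sprob s))"

text \<open>The sum ranges over a set of states, so two runs ending in one state would be counted
  once. Only a coin splits a run, and there the histories keep the two families of final states
  disjoint.\<close>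

lemma sum_terminals:
  assumes "f \<in> schedulers" "0 \<le> a"
  shows "(\<Sum>s\<in>terminals f n (P, \<eta>, a, w). weight s) = ennreal (of_rat a * mass f n P \<eta> w)"
  using assms(2)
proof (induction n arbitrary: P \<eta> a w)
  case 0
  then show ?case by (simp add: sprob_def)
next
  case (Suc n)
  show ?case
  proof (cases "act P \<eta>")
    case Halt
    then have "P = Bot" by (simp add: act_Halt_iff)
    then show ?thesis by (simp add: sprob_def)
  next
    case (Tau P' \<eta>' u)
    then have "P \<noteq> Bot" using act_Halt_iff[of P \<eta>] by auto
    with Tau Suc show ?thesis by (simp add: succs_def)
  next
    case (Choose A B)
    then have P: "P \<noteq> Bot" using act_Halt_iff[of P \<eta>] by auto
    from assms(1) have "f w = Ln \<or> f w = Rn" by (auto simp: schedulers_def)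
    with P Choose Suc show ?thesis by (auto simp: succs_def)
  next
    case (Coin p A B)
    then have P: "P \<noteq> Bot" using act_Halt_iff[of P \<eta>] by auto
    let ?S = "terminals f n (A, \<eta>, a * p, w @ [Lp])" and ?T = "terminals f n (B, \<eta>, a * (1 - p), w @ [Rp])"
    have p: "0 < p" "p < 1" using act_Coin[OF Coin] by auto
    have "?S \<inter> ?T = {}"
    proof (rule equals0I)
      fix s assume "s \<in> ?S \<inter> ?T"
      then obtain u v where "snd (snd (snd s)) = (w @ [Lp]) @ u" "snd (snd (snd s)) = (w @ [Rp]) @ v"
        using terminals_history by blast
      then show False by simp
    qed
    have "terminals f (Suc n) (P, \<eta>, a, w) = ?S \<union> ?T"
      using P Coin by (simp add: succs_def)
    then have "(\<Sum>s\<in>terminals f (Suc n) (P, \<eta>, a, w). weight s) = (\<Sum>s\<in>?S. weight s) + (\<Sum>s\<in>?T. weight s)"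
      using sum.union_disjoint[OF finite_terminals finite_terminals \<open>?S \<inter> ?T = {}\<close>] by simp
    also have "\<dots> = ennreal (of_rat (a * p) * mass f n A \<eta> (w @ [Lp]))
        + ennreal (of_rat (a * (1 - p)) * mass f n B \<eta> (w @ [Rp]))"
      using Suc.prems p by (simp add: Suc.IH)
    also have "\<dots> = ennreal (of_rat (a * p) * mass f n A \<eta> (w @ [Lp])
        + of_rat (a * (1 - p)) * mass f n B \<eta> (w @ [Rp]))"
      using Suc.prems p mass_bounds by (intro ennreal_plus[symmetric] mult_nonneg_nonneg) auto
    also have "of_rat (a * p) * mass f n A \<eta> (w @ [Lp]) + of_rat (a * (1 - p)) * mass f n B \<eta> (w @ [Rp])
        = of_rat a * mass f (Suc n) P \<eta> w"
      unfolding mass.simps(2) Coin action.case by (simp add: of_rat_mult of_rat_diff algebra_simps)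
    finally show ?thesis .
  qed
qed

lemma reachable_terminals:
  "{s. (step f)\<^sup>*\<^sup>* s0 s \<and> terminal s} = (\<Union>n. terminals f n s0)"
proof (intro equalityI subsetI)
  fix s assume "s \<in> {s. (step f)\<^sup>*\<^sup>* s0 s \<and> terminal s}"
  then have "(step f)\<^sup>*\<^sup>* s0 s" and t: "terminal s" by auto
  then have "\<exists>n. s \<in> terminals f n s0"
  proof (induction rule: converse_rtranclp_induct)
    case base
    from t have "s \<in> terminals f 0 s" by simp
    then show ?case ..
  next
    case (step y z)
    then obtain n where "s \<in> terminals f n z" by blast
    moreover from step.hyps(1) have "z \<in> succs f y" by (rule step_imp_succs)
    moreover from this have "\<not> terminal y" by (cases y) (auto simp: succs_def)
    ultimately have "s \<in> terminals f (Suc n) y" by auto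
    then show ?case ..
  qed
  then show "s \<in> (\<Union>n. terminals f n s0)" by blast
next
  have "(step f)\<^sup>*\<^sup>* s0 s \<and> terminal s" if "s \<in> terminals f n s0" for n s s0
    using that
  proof (induction n arbitrary: s0)
    case 0
    then show ?case by (simp split: if_splits)
  next
    case (Suc n)
    show ?case
    proof (cases "terminal s0")
      case True
      with Suc.prems show ?thesis by simp
    next
      case False
      with Suc.prems obtain s' where "s' \<in> succs f s0" "s \<in> terminals f n s'" by auto
      moreover from this(1) have "step f s0 s'" by (simp only: step_iff_succs)
      ultimately show ?thesis
        using Suc.IH[of s'] converse_rtranclp_into_rtranclp[of "step f" s0 s' s] by simp
    qed
  qed
  then show "s \<in> (\<Union>n. terminals f n s0) \<Longrightarrow> s \<in> {s. (step f)\<^sup>*\<^sup>* s0 s \<and> terminal s}" for s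
    by blast
qed

text \<open>A nonnegative \<open>infsum\<close> is the supremum over finite subsets, and a finite
  set of reachable terminal states lies within one stage of the increasing family
  \<open>terminals\<close>.\<close>

lemma Pr_term_eq_SUP:
  assumes "f \<in> schedulers"
  shows "Pr_term P f = (SUP n. ennreal (mass f n P (\<lambda>_. 0) []))"
proof -
  let ?T = "\<lambda>n. terminals f n (init_state P)"
  have T: "(\<Sum>s\<in>?T n. weight s) = ennreal (mass f n P (\<lambda>_. 0) [])" for n
    using sum_terminals[OF assms, of 1] by (simp add: init_state_def)
  have P: "Pr_term P f = (SUP F\<in>{F. finite F \<and> F \<subseteq> (\<Union>n. ?T n)}. \<Sum>s\<in>F. weight s)"
    unfolding Pr_term_def reachable_terminals by (rule nonneg_infsum_complete) simp
  show ?thesis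
  proof (rule antisym)
    show "Pr_term P f \<le> (SUP n. ennreal (mass f n P (\<lambda>_. 0) []))"
      unfolding P
    proof (rule SUP_least)
      fix F assume "F \<in> {F. finite F \<and> F \<subseteq> (\<Union>n. ?T n)}"
      then have F: "finite F" "F \<subseteq> (\<Union>n. ?T n)" by auto
      have "\<exists>n. F \<subseteq> ?T n"
        using F
      proof (induction F rule: finite_induct)
        case (insert s F)
        then obtain m n where "s \<in> ?T m" "F \<subseteq> ?T n" by auto
        then have "insert s F \<subseteq> ?T (max m n)"
          using terminals_le[of m "max m n" f "init_state P"] terminals_le[of n "max m n" f "init_state P"]
          by auto
        then show ?case ..
      qed simp
      then obtain n where "F \<subseteq> ?T n" ..
      then have "(\<Sum>s\<in>F. weight s) \<le> (\<Sum>s\<in>?T n. weight s)"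
        by (intro sum_mono2 finite_terminals) auto
      then show "(\<Sum>s\<in>F. weight s) \<le> (SUP n. ennreal (mass f n P (\<lambda>_. 0) []))"
        unfolding T by (rule order_trans) (rule SUP_upper, simp)
    qed
    show "(SUP n. ennreal (mass f n P (\<lambda>_. 0) [])) \<le> Pr_term P f"
      unfolding P T[symmetric]
    proof (rule SUP_least)
      fix n
      show "(\<Sum>s\<in>?T n. weight s) \<le> (SUP F\<in>{F. finite F \<and> F \<subseteq> (\<Union>n. ?T n)}. \<Sum>s\<in>F. weight s)"
        by (rule SUP_upper) (auto simp: finite_terminals)
    qed
  qed
qed

section \<open>Certificates are sound\<close>

text \<open>Induction on the certificate, with \<open>f\<close> arbitrary and \<open>w\<close>
  generalised because subtrees continue with longer histories. The step count may depend on
  \<open>f\<close>; at a coin the larger of two counts serves both branches.\<close>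

lemma cert_imp_mass:
  "cert P \<eta> q \<Longrightarrow> \<exists>n. of_rat q \<le> mass f n P \<eta> w"
proof (induction arbitrary: w rule: cert.induct)
  case (cert_nonpos q P \<eta>)
  then have "of_rat q \<le> (0::real)" by simp
  then show ?case using mass_bounds order_trans by blast
next
  case (cert_Halt q P \<eta>)
  then show ?case by (intro exI[of _ 0]) (simp add: act_Halt_iff)
next
  case (cert_Tau P \<eta> P' \<eta>' u q)
  then obtain n where "of_rat q \<le> mass f n P' \<eta>' (w @ u)" by blast
  with cert_Tau.hyps(1) show ?case by (intro exI[of _ "Suc n"]) simp
next
  case (cert_Coin P \<eta> p A B r s)
  obtain m where m: "of_rat r \<le> mass f m A \<eta> (w @ [Lp])" using cert_Coin.IH(1) by blast
  obtain n where n: "of_rat s \<le> mass f n B \<eta> (w @ [Rp])" using cert_Coin.IH(2) by blast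
  have "of_rat r \<le> mass f (max m n) A \<eta> (w @ [Lp])" "of_rat s \<le> mass f (max m n) B \<eta> (w @ [Rp])"
    using order_trans[OF m mass_le] order_trans[OF n mass_le] by simp_all
  then have "of_rat p * of_rat r + (1 - of_rat p) * of_rat s \<le> mass f (Suc (max m n)) P \<eta> w"
    using of_rat_Coin[OF cert_Coin.hyps(1)] unfolding mass.simps(2) cert_Coin.hyps(1) action.case
    by (intro add_mono mult_left_mono) auto
  then show ?case by (intro exI[of _ "Suc (max m n)"]) (simp add: of_rat_add of_rat_mult of_rat_diff)
next
  case (cert_Choose P \<eta> A B q)
  obtain m where "of_rat q \<le> mass f m A \<eta> (w @ [Ln])" using cert_Choose.IH(1) by blast
  moreover obtain n where "of_rat q \<le> mass f n B \<eta> (w @ [Rn])" using cert_Choose.IH(2) by blast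
  ultimately show ?case
    using cert_Choose.hyps(1)
    by (cases "f w = Ln") (auto intro: exI[of _ "Suc m"] exI[of _ "Suc n"])
qed

section \<open>A minimizing scheduler\<close>

lemma cert_le_1: "cert P \<eta> q \<Longrightarrow> q \<le> 1"
proof (induction rule: cert.induct)
  case (cert_Coin P \<eta> p A B r s)
  have "p * r \<le> p * 1" "(1 - p) * s \<le> (1 - p) * 1"
    using act_Coin[OF cert_Coin.hyps(1)] cert_Coin.IH by (intro mult_left_mono; simp)+
  then show ?case by simp
qed auto

lemma cert_mono: "cert P \<eta> q \<Longrightarrow> q' \<le> q \<Longrightarrow> cert P \<eta> q'"
proof (induction arbitrary: q' rule: cert.induct)
  case (cert_nonpos q P \<eta>)
  then show ?case by (intro cert.cert_nonpos) simp
next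
  case (cert_Halt q P \<eta>)
  then show ?case by (intro cert.cert_Halt) simp_all
next
  case (cert_Tau P \<eta> P' \<eta>' w q)
  from cert.cert_Tau[OF cert_Tau.hyps(1) cert_Tau.IH[OF cert_Tau.prems]] show ?case .
next
  case (cert_Coin P \<eta> p A B r s)
  \<comment> \<open>Lowering both branch bounds by the same amount lowers their weighted mean by
    that amount. A lowered bound may be negative, which certificates allow.\<close>
  let ?d = "p * r + (1 - p) * s - q'"
  have "cert A \<eta> (r - ?d)" "cert B \<eta> (s - ?d)"
    using cert_Coin.prems by (auto intro!: cert_Coin.IH)
  from cert.cert_Coin[OF cert_Coin.hyps(1) this]
  have "cert P \<eta> (p * (r - ?d) + (1 - p) * (s - ?d))" .
  moreover have "p * (r - ?d) + (1 - p) * (s - ?d) = q'" by (simp add: algebra_simps)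
  ultimately show ?case by simp
next
  case (cert_Choose P \<eta> A B q)
  from cert.cert_Choose[OF cert_Choose.hyps(1) cert_Choose.IH(1)[OF cert_Choose.prems] cert_Choose.IH(2)[OF cert_Choose.prems]]
  show ?case .
qed

definition val :: "prog \<Rightarrow> valuation \<Rightarrow> real" where
  "val P \<eta> = Sup {of_rat q |q. cert P \<eta> q}"

lemma val_set: "{of_rat q |q. cert P \<eta> q} \<noteq> ({} :: real set)" "bdd_above {real_of_rat q |q. cert P \<eta> q}"
proof -
  show "{of_rat q |q. cert P \<eta> q} \<noteq> ({} :: real set)" using cert_nonpos[of 0 P \<eta>] by blast
  show "bdd_above {real_of_rat q |q. cert P \<eta> q}"
    by (rule bdd_aboveI[of _ 1]) (auto dest: cert_le_1)
qed

lemma cert_le_val: "cert P \<eta> q \<Longrightarrow> of_rat q \<le> val P \<eta>"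
  unfolding val_def by (intro cSup_upper val_set(2)) blast

lemma val_le: "(\<And>q. cert P \<eta> q \<Longrightarrow> of_rat q \<le> x) \<Longrightarrow> val P \<eta> \<le> x"
  unfolding val_def by (intro cSup_least val_set(1)) blast

text \<open>Strictness matters because the supremum need not be attained: an almost surely
  terminating loop may have no certificate for 1 itself.\<close>

lemma less_val_cert:
  assumes "of_rat q < val P \<eta>"
  shows "cert P \<eta> q"
proof -
  from assms have "\<exists>x\<in>{of_rat q |q. cert P \<eta> q}. real_of_rat q < x"
    by (simp only: val_def less_cSup_iff[OF val_set])
  then obtain r where r: "cert P \<eta> r" "real_of_rat q < of_rat r"
    by (elim bexE CollectE exE conjE) simp
  from r(2) have "q \<le> r" by (simp add: of_rat_less)
  with r(1) show ?thesis by (rule cert_mono)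
qed

lemma val_nonneg: "0 \<le> val P \<eta>"
  using cert_le_val[of P \<eta> 0] cert_nonpos[of 0 P \<eta>] by simp

lemma val_Halt: "act P \<eta> = Halt \<Longrightarrow> 1 \<le> val P \<eta>"
  using cert_le_val[of P \<eta> 1] cert_Halt[of 1 P \<eta>] by simp

lemma val_Tau:
  assumes "act P \<eta> = Tau P' \<eta>' w"
  shows "val P' \<eta>' \<le> val P \<eta>"
  using cert_le_val[OF cert_Tau[OF assms]] by (rule val_le)

text \<open>The suprema are taken one branch at a time: first over \<open>r\<close> with
  \<open>s\<close> fixed, then over \<open>s\<close>, each time with the inequality solved for the
  value being bounded.\<close>

lemma val_Coin:
  assumes "act P \<eta> = Coin p A B"
  shows "of_rat p * val A \<eta> + (1 - of_rat p) * val B \<eta> \<le> val P \<eta>"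
proof -
  let ?p = "of_rat p :: real"
  have p: "0 < ?p" "?p < 1" using of_rat_Coin[OF assms] by auto
  have 1: "?p * of_rat r + (1 - ?p) * of_rat s \<le> val P \<eta>" if "cert A \<eta> r" "cert B \<eta> s" for r s
    using cert_le_val[OF cert_Coin[OF assms that]] by (simp add: of_rat_add of_rat_mult of_rat_diff)
  have 2: "val A \<eta> \<le> (val P \<eta> - (1 - ?p) * of_rat s) / ?p" if "cert B \<eta> s" for s
  proof (rule val_le)
    fix r assume "cert A \<eta> r"
    from 1[OF this that] show "of_rat r \<le> (val P \<eta> - (1 - ?p) * of_rat s) / ?p"
      using p(1) by (simp add: pos_le_divide_eq algebra_simps)
  qed
  have "val B \<eta> \<le> (val P \<eta> - ?p * val A \<eta>) / (1 - ?p)"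
  proof (rule val_le)
    fix s assume "cert B \<eta> s"
    from 2[OF this] have "?p * val A \<eta> + (1 - ?p) * of_rat s \<le> val P \<eta>"
      using p(1) by (simp add: pos_le_divide_eq algebra_simps)
    then show "of_rat s \<le> (val P \<eta> - ?p * val A \<eta>) / (1 - ?p)"
      using p(2) by (simp add: pos_le_divide_eq algebra_simps)
  qed
  then show ?thesis using p(2) by (simp add: pos_le_divide_eq algebra_simps)
qed

text \<open>Density of the rationals provides one \<open>q\<close> that certifies both branches, as
  \<open>cert_Choose\<close> requires.\<close>

lemma val_Choose:
  assumes "act P \<eta> = Choose A B"
  shows "min (val A \<eta>) (val B \<eta>) \<le> val P \<eta>"
proof (rule ccontr)
  assume "\<not> ?thesis"
  then have "val P \<eta> < min (val A \<eta>) (val B \<eta>)" by (simp only: not_le)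
  from of_rat_dense[OF this]
  obtain q where "val P \<eta> < of_rat q" "of_rat q < min (val A \<eta>) (val B \<eta>)" by blast
  moreover from this(2) have "cert P \<eta> q"
    by (intro cert_Choose[OF assms] less_val_cert) simp_all
  ultimately show False using cert_le_val[of P \<eta> q] by simp
qed

text \<open>The scheduler only sees the history \<open>w\<close>, so it recomputes the current program and
  valuation by replaying the run along \<open>w\<close>; replaying gets stuck at a branching once \<open>w\<close> is used up.\<close>

primrec replay :: "prog \<Rightarrow> dir list \<Rightarrow> nat \<Rightarrow> prog \<times> valuation \<times> dir list" where
  "replay P0 w 0 = (P0, (\<lambda>_. 0), [])"
| "replay P0 w (Suc k) = (case replay P0 w k of (P, \<eta>, v) \<Rightarrow> (case act P \<eta> of
      Halt \<Rightarrow> (P, \<eta>, v)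
    | Tau P' \<eta>' u \<Rightarrow> (P', \<eta>', v @ u)
    | Coin p A B \<Rightarrow> if length v < length w
        then (if w ! length v = Lp then A else B, \<eta>, v @ [w ! length v]) else (P, \<eta>, v)
    | Choose A B \<Rightarrow> if length v < length w
        then (if w ! length v = Ln then A else B, \<eta>, v @ [w ! length v]) else (P, \<eta>, v)))"

text \<open>Some \<open>k\<close> suffices because the replay waits at a choice once
  \<open>w\<close> is used up. \<open>Rn\<close> is also the default at histories where no choice is
  pending.\<close>

definition min_scheduler :: "prog \<Rightarrow> dir list \<Rightarrow> dir" where
  "min_scheduler P0 w = (if \<exists>k P \<eta> A B. replay P0 w k = (P, \<eta>, w) \<and> act P \<eta> = Choose A B
     \<and> val A \<eta> \<le> val B \<eta> then Ln else Rn)"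

lemma replay_stuck:
  assumes "replay P0 w k = (P, \<eta>, w)" "act P \<eta> = Choose A B"
  shows "replay P0 w (k + j) = (P, \<eta>, w)"
  using assms by (induction j) simp_all

lemma min_scheduler_eq:
  assumes "replay P0 w k = (P, \<eta>, w)" "act P \<eta> = Choose A B"
  shows "min_scheduler P0 w = (if val A \<eta> \<le> val B \<eta> then Ln else Rn)"
proof -
  have "P' = P \<and> \<eta>' = \<eta> \<and> A' = A \<and> B' = B"
    if "replay P0 w k' = (P', \<eta>', w)" "act P' \<eta>' = Choose A' B'" for k' P' \<eta>' A' B'
  proof -
    \<comment> \<open>Both configurations persist, so they can be compared at the common index
      \<open>k + k'\<close>.\<close>
    from replay_stuck[OF assms, of k'] replay_stuck[OF that, of k]
    have "P' = P \<and> \<eta>' = \<eta>" by (simp add: add.commute)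
    with that(2) assms(2) show ?thesis by simp
  qed
  with assms show ?thesis unfolding min_scheduler_def by (metis (no_types, lifting))
qed

lemma min_scheduler_in_schedulers: "min_scheduler P0 \<in> schedulers"
  by (simp add: schedulers_def min_scheduler_def)

text \<open>The replay consults the scheduler's later, longer histories, whereas the run has
  produced only the prefix \<open>w\<close>; hence the quantification over continuations. Each
  recorded letter moves from \<open>w'\<close> into \<open>w\<close>.\<close>

lemma mass_min_scheduler:
  assumes "\<And>w'. replay P0 (w @ w') k = (P, \<eta>, w)"
  shows "mass (min_scheduler P0) n P \<eta> w \<le> val P \<eta>"
  using assms
proof (induction n arbitrary: P \<eta> w k)
  case 0
  then show ?case using val_nonneg[of P \<eta>] val_Halt[of P \<eta>] by (simp add: act_Halt_iff)
next
  case (Suc n)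
  let ?m = "mass (min_scheduler P0) n"
  show ?case
  proof (cases "act P \<eta>")
    case Halt
    then show ?thesis using val_Halt by simp
  next
    case (Tau P' \<eta>' u)
    have "replay P0 ((w @ u) @ w') (Suc k) = (P', \<eta>', w @ u)" for w'
      using Suc.prems[of "u @ w'"] Tau by simp
    from Suc.IH[OF this] val_Tau[OF Tau] Tau show ?thesis by simp
  next
    case (Coin p A B)
    have "replay P0 ((w @ [Lp]) @ w') (Suc k) = (A, \<eta>, w @ [Lp])" for w'
      using Suc.prems[of "Lp # w'"] Coin by simp
    note A = Suc.IH[OF this]
    have "replay P0 ((w @ [Rp]) @ w') (Suc k) = (B, \<eta>, w @ [Rp])" for w'
      using Suc.prems[of "Rp # w'"] Coin by simp
    note B = Suc.IH[OF this]
    have "of_rat p * ?m A \<eta> (w @ [Lp]) + (1 - of_rat p) * ?m B \<eta> (w @ [Rp])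
        \<le> of_rat p * val A \<eta> + (1 - of_rat p) * val B \<eta>"
      using of_rat_Coin[OF Coin] A B by (intro add_mono mult_left_mono) auto
    also have "\<dots> \<le> val P \<eta>" by (rule val_Coin[OF Coin])
    finally show ?thesis using Coin by simp
  next
    case (Choose A B)
    have "replay P0 ((w @ [Ln]) @ w') (Suc k) = (A, \<eta>, w @ [Ln])" for w'
      using Suc.prems[of "Ln # w'"] Choose by simp
    note A = Suc.IH[OF this]
    have "replay P0 ((w @ [Rn]) @ w') (Suc k) = (B, \<eta>, w @ [Rn])" for w'
      using Suc.prems[of "Rn # w'"] Choose by simp
    note B = Suc.IH[OF this]
    \<comment> \<open>The empty continuation gives the replay along \<open>w\<close> itself, the
      history on which the scheduler now decides.\<close>
    have "min_scheduler P0 w = (if val A \<eta> \<le> val B \<eta> then Ln else Rn)"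
      using Suc.prems[of "[]"] by (intro min_scheduler_eq[OF _ Choose]) simp
    with A B val_Choose[OF Choose] Choose show ?thesis by (auto split: if_splits)
  qed
qed

lemma AST_iff_cert: "P \<in> AST \<longleftrightarrow> (\<forall>x::nat. cert P (\<lambda>_. 0) (1 - 1 / (of_nat x + 1)))"
proof
  assume "P \<in> AST"
  let ?f = "min_scheduler P"
  have "mass ?f n P (\<lambda>_. 0) [] \<le> val P (\<lambda>_. 0)" for n
    by (rule mass_min_scheduler[of P "[]" 0]) simp
  then have "Pr_term P ?f \<le> ennreal (val P (\<lambda>_. 0))"
    unfolding Pr_term_eq_SUP[OF min_scheduler_in_schedulers]
    by (intro SUP_least ennreal_leI)
  moreover have "Pr_term P ?f = 1"
    using \<open>P \<in> AST\<close> min_scheduler_in_schedulers by (simp add: AST_def)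
  ultimately have "1 \<le> val P (\<lambda>_. 0)" by simp
  show "\<forall>x::nat. cert P (\<lambda>_. 0) (1 - 1 / (of_nat x + 1))"
  proof
    fix x :: nat
    \<comment> \<open>The threshold lies strictly below 1 and so below the value, as
      \<open>less_val_cert\<close> demands.\<close>
    have "(1 - 1 / (of_nat x + 1) :: rat) < 1" by simp
    then have "real_of_rat (1 - 1 / (of_nat x + 1)) < 1" by (simp only: of_rat_less_1_iff)
    with \<open>1 \<le> val P (\<lambda>_. 0)\<close> show "cert P (\<lambda>_. 0) (1 - 1 / (of_nat x + 1))"
      by (intro less_val_cert) linarith
  qed
next
  assume c: "\<forall>x::nat. cert P (\<lambda>_. 0) (1 - 1 / (of_nat x + 1))"
  have "Pr_term P f = 1" if f: "f \<in> schedulers" for f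
  proof (rule antisym)
    show "Pr_term P f \<le> 1"
      unfolding Pr_term_eq_SUP[OF f] using mass_bounds by (intro SUP_least) (simp add: ennreal_le_1)
    have "ennreal (1 - 1 / (real x + 1)) \<le> Pr_term P f" for x
    proof -
      obtain n where "real_of_rat (1 - 1 / (of_nat x + 1)) \<le> mass f n P (\<lambda>_. 0) []"
        using cert_imp_mass[OF c[rule_format, of x]] by blast
      then have "ennreal (1 - 1 / (real x + 1)) \<le> ennreal (mass f n P (\<lambda>_. 0) [])"
        by (intro ennreal_leI) (simp add: of_rat_diff of_rat_divide of_rat_add)
      also have "\<dots> \<le> Pr_term P f" unfolding Pr_term_eq_SUP[OF f] by (rule SUP_upper) simp
      finally show ?thesis .
    qed
    moreover have "(\<lambda>x. ennreal (1 - 1 / (real x + 1))) \<longlonglongrightarrow> ennreal 1"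
    proof (rule tendsto_ennrealI)
      have "(\<lambda>x. 1 - 1 / (real x + 1)) \<longlonglongrightarrow> 1 - 0"
        using LIMSEQ_inverse_real_of_nat
        by (intro tendsto_diff tendsto_const) (simp add: inverse_eq_divide add.commute)
      then show "(\<lambda>x. 1 - 1 / (real x + 1)) \<longlonglongrightarrow> 1" by simp
    qed
    ultimately show "1 \<le> Pr_term P f"
      using LIMSEQ_le_const2[of "\<lambda>x. ennreal (1 - 1 / (real x + 1))" "ennreal 1"] by auto
  qed
  then show "P \<in> AST" by (simp add: AST_def)
qed

theorem theoremB4:
  shows "Pi02 (prog_code ` AST)"
proof -
  have "AST = {P. \<forall>x::nat. cert P (\<lambda>_. 0) (1 - 1 / (of_nat x + 1))}"
    using AST_iff_cert by blast
  then show ?thesis using Pi02_cert by simp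
qed

end
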